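(* For any non-degenerate triangle $ABC$, $$\Sigma(\triangle ABC)=F(\Pi^+)=\operatorname{int}(\mathrm{CFT})\cup F(\mathrm{SRT}),$$ where $\operatorname{int}$ denotes the interior in $\mathbb{R}^3$.
   Context: Let $\Pi^0=\{(p,q,0)\}\subset\mathbb{R}^3$ and $\Pi^+=\{(p,q,r)\in\mathbb{R}^3\mid r>0\}$; $ABC$ is a non-degenerate triangle in $\Pi^0$. $\Sigma(\triangle ABC)$ is the set of all triples $(\cos\angle BDC,\cos\angle ADC,\cos\angle ADB)$ where $D$ ranges over the points of $\mathbb{R}^3$ outside the plane $ABC$. Put $\mathrm{GT}=\Pi^+\cup(\Pi^0\setminus\{A,B,C\})$ and $F:\mathrm{GT}\to\mathbb{R}^3$, $F(D)=(\cos\angle BDC,\cos\angle ADC,\cos\angle ADB)$. $\mathrm{CFT}$ is the closure of $F(\mathrm{GT})$ in $\mathbb{R}^3$. $S\subset\Pi^0$ is the circumscribed circle of $ABC$ and $\mathrm{Cyl}=S\times(-\infty,\infty)$. For points $K\ne L$ and an angle $\alpha$, the toroid is $\mathbb{T}_{KL}^{\alpha}=\{M\in\mathbb{R}^3\mid \angle KML=\alpha\}$ (with $K,L$ excluded). Let $\alpha_1=\angle BAC$, $\alpha_2=\angle ABC$, $\alpha_3=\angle ACB$, and let $\gamma_{BC}=\mathbb{T}_{BC}^{\alpha_1}\cap\mathrm{Cyl}\cap\Pi^+$, $\gamma_{AC}=\mathbb{T}_{AC}^{\alpha_2}\cap\mathrm{Cyl}\cap\Pi^+$, $\gamma_{AB}=\mathbb{T}_{AB}^{\alpha_3}\cap\mathrm{Cyl}\cap\Pi^+$.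 A curve whose angle $\alpha_i$ is $\ge\pi/2$ is empty; if the angle is acute, the curve is the graph of a positive height function over an open half-circle of $S$. A special region of $\mathrm{Cyl}$ is a region bounded by two of these curves (both nonempty) and by the plane $\Pi^0$; explicitly, for two nonempty curves $\gamma,\gamma'$ among the three it is the set of all points $(p,q,r)\in\mathrm{Cyl}$ with $r>0$ for which there are $r_1\ge r$ and $r_2\ge r$ with $(p,q,r_1)\in\gamma$ and $(p,q,r_2)\in\gamma'$. $\mathrm{SRT}$ is the set of points $D\in\mathrm{Cyl}$ such that $D$ lies in some special region of $\mathrm{Cyl}$ or in the boundary of a special region in $\mathrm{Cyl}\cap\Pi^+$. *)

theory Defs
  imports "HOL-Analysis.Analysis"
begin

(* Angle KML at the vertex M.  Only used for M distinct from K and L. *)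
definition angle :: "real^3 \<Rightarrow> real^3 \<Rightarrow> real^3 \<Rightarrow> real" where
  "angle K M L = arccos (((K - M) \<bullet> (L - M)) / (norm (K - M) * norm (L - M)))"

definition Pi_zero :: "(real^3) set" where
  "Pi_zero = {vector [p, q, 0] | p q. True}"

definition Pi_plus :: "(real^3) set" where
  "Pi_plus = {vector [p, q, r] | p q r. r > 0}"

definition cos_triple :: "real^3 \<Rightarrow> real^3 \<Rightarrow> real^3 \<Rightarrow> real^3 \<Rightarrow> real^3" where
  "cos_triple A B C D = vector [cos (angle B D C), cos (angle A D C), cos (angle A D B)]"

definition Sigma_tri :: "real^3 \<Rightarrow> real^3 \<Rightarrow> real^3 \<Rightarrow> (real^3) set" where
  "Sigma_tri A B C = {cos_triple A B C D | D. D \<notin> affine hull {A, B, C}}"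

definition GT :: "real^3 \<Rightarrow> real^3 \<Rightarrow> real^3 \<Rightarrow> (real^3) set" where
  "GT A B C = Pi_plus \<union> (Pi_zero - {A, B, C})"

(* The map F is cos_triple A B C restricted to GT A B C; outside GT its values are never used. *)
definition CFT :: "real^3 \<Rightarrow> real^3 \<Rightarrow> real^3 \<Rightarrow> (real^3) set" where
  "CFT A B C = closure (cos_triple A B C ` GT A B C)"

(* For a non-degenerate triangle in Pi_zero the centre Z is uniquely determined. *)
definition circumcircle :: "real^3 \<Rightarrow> real^3 \<Rightarrow> real^3 \<Rightarrow> (real^3) set" where
  "circumcircle A B C = {P \<in> Pi_zero. \<exists>Z \<in> Pi_zero.
     dist Z A = dist Z B \<and> dist Z B = dist Z C \<and> dist Z P = dist Z A}"

definition Cyl :: "real^3 \<Rightarrow> real^3 \<Rightarrow> real^3 \<Rightarrow> (real^3) set" where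
  "Cyl A B C = {vector [p, q, r] | p q r. vector [p, q, 0] \<in> circumcircle A B C}"

definition toroid :: "real^3 \<Rightarrow> real^3 \<Rightarrow> real \<Rightarrow> (real^3) set" where
  "toroid K L \<alpha> = {M. M \<noteq> K \<and> M \<noteq> L \<and> angle K M L = \<alpha>}"

definition gamma_BC :: "real^3 \<Rightarrow> real^3 \<Rightarrow> real^3 \<Rightarrow> (real^3) set" where
  "gamma_BC A B C = toroid B C (angle B A C) \<inter> Cyl A B C \<inter> Pi_plus"

definition gamma_AC :: "real^3 \<Rightarrow> real^3 \<Rightarrow> real^3 \<Rightarrow> (real^3) set" where
  "gamma_AC A B C = toroid A C (angle A B C) \<inter> Cyl A B C \<inter> Pi_plus"

definition gamma_AB :: "real^3 \<Rightarrow> real^3 \<Rightarrow> real^3 \<Rightarrow> (real^3) set" where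
  "gamma_AB A B C = toroid A B (angle A C B) \<inter> Cyl A B C \<inter> Pi_plus"

definition region_below ::
    "real^3 \<Rightarrow> real^3 \<Rightarrow> real^3 \<Rightarrow> (real^3) set \<Rightarrow> (real^3) set \<Rightarrow> (real^3) set" where
  "region_below A B C \<gamma> \<gamma>' = {vector [p, q, r] | p q r.
     vector [p, q, r] \<in> Cyl A B C \<and> r > 0 \<and>
     (\<exists>r1 r2. r1 \<ge> r \<and> r2 \<ge> r \<and> vector [p, q, r1] \<in> \<gamma> \<and> vector [p, q, r2] \<in> \<gamma>')}"

definition special_regions :: "real^3 \<Rightarrow> real^3 \<Rightarrow> real^3 \<Rightarrow> (real^3) set set" where
  "special_regions A B C = {region_below A B C \<gamma> \<gamma>' | \<gamma> \<gamma>'.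
     (\<gamma>, \<gamma>') \<in> {(gamma_BC A B C, gamma_AC A B C),
                (gamma_BC A B C, gamma_AB A B C),
                (gamma_AC A B C, gamma_AB A B C)} \<and>
     \<gamma> \<noteq> {} \<and> \<gamma>' \<noteq> {}}"

(* The boundary is taken relative to the part of the cylinder above the plane. *)
definition SRT :: "real^3 \<Rightarrow> real^3 \<Rightarrow> real^3 \<Rightarrow> (real^3) set" where
  "SRT A B C = {D \<in> Cyl A B C. \<exists>R \<in> special_regions A B C.
     D \<in> R \<or> D \<in> top_of_set (Cyl A B C \<inter> Pi_plus) frontier_of R}"

end

theory Submission
  imports Defs
begin

text \<open>
  Write \<open>q = (u, v, w)\<close> for a triple of cosines, \<open>x, y, z\<close> for the distances of the apex from \<open>A, B, C\<close>
  and \<open>a, b, c\<close> for the sides opposite to \<open>A, B, C\<close>. If the Gram determinant of \<open>q\<close> is positive, then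
  \<open>q\<close> lies in \<open>F(\<Pi>\<^sup>+)\<close> iff the three cosine laws have a solution with \<open>x, y, z > 0\<close>.

  Off the cylinder the Jacobian of \<open>F\<close> does not vanish, so \<open>F\<close> is open there. If \<open>D\<close> lies on the cylinder
  but not in SRT, then two of the three angles at \<open>D\<close>, say those over \<open>BC\<close> and \<open>AC\<close>, are smaller than those of the
  triangle. In this case the cosine laws are solvable for every \<open>w\<close>: on the curve of all solutions of the first two
  laws there is an arc whose end points satisfy \<open>xy = 0\<close>, with \<open>x\<^sup>2 + y\<^sup>2 < c\<^sup>2\<close> at one end and
  \<open>x\<^sup>2 + y\<^sup>2 > c\<^sup>2\<close> at the other, and the third law holds somewhere in between. So \<open>F(D)\<close> has a neighbourhood in
  \<open>F(\<Pi>\<^sup>+)\<close>.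

  Conversely, near an interior point \<open>q\<close> of CFT the cosine laws have solutions with \<open>x, y, z \<ge> 0\<close>.
  A solution at \<open>q\<close> with \<open>x = 0\<close> forces \<open>u = cos \<alpha>\<^sub>1\<close>, and the solutions with small \<open>x\<close> stay on one
  side of this plane. Hence \<open>q\<close> can be approached in a direction that is not reached by solutions
  with a vanishing coordinate, and the limit of the solutions is positive.
\<close>

subsection \<open>Existence of solutions when two angles are smaller than those of the triangle\<close>

text \<open>The perspective-three-point equations: the cosine laws in the three lateral faces.\<close>

definition p3p :: "real \<Rightarrow> real \<Rightarrow> real \<Rightarrow> real \<Rightarrow> real \<Rightarrow> real \<Rightarrow> real \<Rightarrow> real \<Rightarrow> real \<Rightarrow> bool" where
  "p3p a b c u v w x y z \<longleftrightarrow>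
     y\<^sup>2 + z\<^sup>2 - 2*y*z*u = a\<^sup>2 \<and> x\<^sup>2 + z\<^sup>2 - 2*x*z * v = b\<^sup>2 \<and> x\<^sup>2 + y\<^sup>2 - 2*x*y*w = c\<^sup>2"

lemma p3p_swap12: "p3p a b c u v w x y z \<longleftrightarrow> p3p b a c v u w y x z"
  by (auto simp: p3p_def algebra_simps)

lemma p3p_swap23: "p3p a b c u v w x y z \<longleftrightarrow> p3p a c b u w v x z y"
  by (auto simp: p3p_def algebra_simps)

lemma conic_pos:
  fixes u y z :: real
  assumes "u\<^sup>2 < 1" "z > 0"
  shows "y\<^sup>2 + z\<^sup>2 - 2*y*z*u > 0"
proof -
  have "y\<^sup>2 + z\<^sup>2 - 2*y*z*u = (y - z*u)\<^sup>2 + (1 - u\<^sup>2) * z\<^sup>2"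
    by (simp add: power2_eq_square algebra_simps)
  also have "\<dots> > 0" using assms by (intro add_nonneg_pos mult_pos_pos) auto
  finally show ?thesis .
qed

text \<open>The path is the radial projection of the chord; it stays above \<open>m\<close> since the ellipse is convex.\<close>

lemma conic_path:
  fixes u a m :: real
  assumes u: "u\<^sup>2 < 1" and a: "a > 0" and m: "m > 0"
    and e0: "y0\<^sup>2 + z0\<^sup>2 - 2*y0*z0*u = a\<^sup>2" and e1: "y1\<^sup>2 + z1\<^sup>2 - 2*y1*z1*u = a\<^sup>2"
    and pos: "y0 \<ge> 0" "y1 \<ge> 0" "z0 \<ge> m" "z1 \<ge> m"
  shows "\<exists>Y Z. continuous_on {0..1} Y \<and> continuous_on {0..1} Z \<and>
    Y 0 = y0 \<and> Z 0 = z0 \<and> Y 1 = y1 \<and> Z 1 = z1 \<and>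
    (\<forall>s\<in>{0..1::real}. (Y s)\<^sup>2 + (Z s)\<^sup>2 - 2 * Y s * Z s * u = a\<^sup>2 \<and> Y s \<ge> 0 \<and> Z s \<ge> m)"
proof -
  define y where "y = (\<lambda>s. (1-s)*y0 + s*y1)"
  define z where "z = (\<lambda>s. (1-s)*z0 + s*z1)"
  define Q where "Q = (\<lambda>s. (y s)\<^sup>2 + (z s)\<^sup>2 - 2 * y s * z s * u)"
  define r where "r = (\<lambda>s. a / sqrt (Q s))"
  have zm: "z s \<ge> m" and y0: "y s \<ge> 0" if "s \<in> {0..1}" for s
  proof -
    have "(1-s)*z0 + s*z1 \<ge> (1-s)*m + s*m"
      using that pos by (intro add_mono mult_left_mono) auto
    then show "z s \<ge> m" by (simp add: z_def algebra_simps)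
    show "y s \<ge> 0" using that pos by (simp add: y_def)
  qed
  have Qpos: "Q s > 0" if "s \<in> {0..1}" for s
    unfolding Q_def using conic_pos[OF u] zm[OF that] m by simp
  have Qle: "Q s \<le> a\<^sup>2" if "s \<in> {0..1}" for s
  proof -
    let ?d = "(y1-y0)\<^sup>2 + (z1-z0)\<^sup>2 - 2*(y1-y0)*(z1-z0)*u"
    have "?d = ((y1-y0) - (z1-z0)*u)\<^sup>2 + (1-u\<^sup>2)*(z1-z0)\<^sup>2"
      by (simp add: power2_eq_square algebra_simps)
    also have "\<dots> \<ge> 0" using u by (intro add_nonneg_nonneg mult_nonneg_nonneg) auto
    finally have d: "?d \<ge> 0" .
    \<comment> \<open>On a chord a quadratic form falls short of the interpolated end values by
      \<open>s * (1-s)\<close> times its value on the difference vector, so the chord lies inside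
      the ellipse.\<close>
    have "Q s = (1-s) * (y0\<^sup>2 + z0\<^sup>2 - 2*y0*z0*u) + s * (y1\<^sup>2 + z1\<^sup>2 - 2*y1*z1*u) - s*(1-s)*?d"
      by (simp add: Q_def y_def z_def power2_eq_square algebra_simps)
    also have "\<dots> = a\<^sup>2 - s*(1-s)*?d" unfolding e0 e1 by (simp add: algebra_simps)
    also have "\<dots> \<le> a\<^sup>2" using d that by simp
    finally show ?thesis .
  qed
  have r1: "r s \<ge> 1" if "s \<in> {0..1}" for s
  proof -
    have "sqrt (Q s) \<le> a" using Qle[OF that] a real_le_lsqrt Qpos[OF that] by (simp add: real_le_lsqrt)
    then show ?thesis using Qpos[OF that] by (simp add: r_def)
  qed
  have on: "(r s * y s)\<^sup>2 + (r s * z s)\<^sup>2 - 2 * (r s * y s) * (r s * z s) * u = a\<^sup>2" if "s \<in> {0..1}" for s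
  proof -
    have "(r s * y s)\<^sup>2 + (r s * z s)\<^sup>2 - 2 * (r s * y s) * (r s * z s) * u = (r s)\<^sup>2 * Q s"
      by (simp add: Q_def power2_eq_square algebra_simps)
    also have "\<dots> = a\<^sup>2" using Qpos[OF that] by (simp add: r_def power_divide)
    finally show ?thesis .
  qed
  have cQ: "continuous_on {0..1} Q"
    unfolding Q_def y_def z_def by (intro continuous_intros)
  have Qn0: "\<forall>s\<in>{0..1}. Q s \<noteq> 0" using Qpos by (metis less_irrefl)
  have cr: "continuous_on {0..1} r"
    unfolding r_def using cQ Qn0
    by (intro continuous_intros) auto
  have r0: "r 0 = 1" "r 1 = 1"
    using e0 e1 a by (auto simp: r_def Q_def y_def z_def)
  show ?thesis
  proof (intro exI conjI ballI)
    show "continuous_on {0..1} (\<lambda>s. r s * y s)" "continuous_on {0..1} (\<lambda>s. r s * z s)"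
      using cr by (auto simp: y_def z_def intro!: continuous_intros)
    fix s :: real assume s: "s \<in> {0..1}"
    show "(r s * y s)\<^sup>2 + (r s * z s)\<^sup>2 - 2 * (r s * y s) * (r s * z s) * u = a\<^sup>2"
      by (rule on[OF s])
    show "r s * y s \<ge> 0" using r1[OF s] y0[OF s] by simp
    have "m * 1 \<le> z s * r s" using r1[OF s] zm[OF s] m by (intro mult_mono) auto
    then show "r s * z s \<ge> m" by (simp add: mult.commute)
  qed (use r0 in \<open>auto simp: y_def z_def\<close>)
qed

text \<open>The law, read as a quadratic in the unknown distance, has roots with sum
  \<open>2*z*v > 0\<close> and product \<open>z^2 - b^2 >= 0\<close>, so even the smaller root is
  nonnegative.\<close>

lemma minus_root:
  fixes z v b :: real
  assumes v: "v > 0" and z: "z \<ge> b" "b > 0" and d: "z\<^sup>2*(1-v\<^sup>2) \<le> b\<^sup>2"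
  shows "z * v - sqrt (b\<^sup>2 - z\<^sup>2*(1-v\<^sup>2)) \<ge> 0"
    "(z * v - sqrt (b\<^sup>2 - z\<^sup>2*(1-v\<^sup>2)))\<^sup>2 + z\<^sup>2 - 2 * (z * v - sqrt (b\<^sup>2 - z\<^sup>2*(1-v\<^sup>2))) * z * v = b\<^sup>2"
proof -
  define t where "t = sqrt (b\<^sup>2 - z\<^sup>2*(1-v\<^sup>2))"
  have t: "t\<^sup>2 = b\<^sup>2 - z\<^sup>2*(1-v\<^sup>2)" unfolding t_def using d by (intro real_sqrt_pow2) simp
  have zv: "0 \<le> z * v" using v z by simp
  have "z\<^sup>2 \<ge> b\<^sup>2" using z by (intro power_mono) auto
  moreover have "(z * v)\<^sup>2 = z\<^sup>2 * v\<^sup>2" by (rule power_mult_distrib)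
  ultimately have "t\<^sup>2 \<le> (z * v)\<^sup>2" unfolding t by (simp add: right_diff_distrib)
  then have "t \<le> z * v" using zv by (rule power2_le_imp_le)
  moreover have "(z * v - t)\<^sup>2 + z\<^sup>2 - 2 * (z * v - t) * z * v = t\<^sup>2 + z\<^sup>2 - z\<^sup>2 * v\<^sup>2"
    by (simp add: power2_eq_square algebra_simps)
  ultimately show "z * v - sqrt (b\<^sup>2 - z\<^sup>2*(1-v\<^sup>2)) \<ge> 0"
    "(z * v - sqrt (b\<^sup>2 - z\<^sup>2*(1-v\<^sup>2)))\<^sup>2 + z\<^sup>2 - 2 * (z * v - sqrt (b\<^sup>2 - z\<^sup>2*(1-v\<^sup>2))) * z * v = b\<^sup>2"
    unfolding t_def[symmetric] by (simp_all add: t right_diff_distrib)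
qed

text \<open>The hypothesis makes the quadratic \<open>t^2 - 2*t*p + k\<close> negative at
  \<open>t = c\<close>, which puts \<open>c\<close> strictly between its two roots.\<close>

lemma between_roots:
  fixes p k c :: real
  assumes "c\<^sup>2 - 2*c*p + k < 0"
  shows "p - sqrt (p\<^sup>2 - k) < c" "c < p + sqrt (p\<^sup>2 - k)" "p\<^sup>2 - k > 0"
proof -
  have h: "(c-p)\<^sup>2 < p\<^sup>2 - k" using assms by (simp add: power2_eq_square algebra_simps)
  then have "\<bar>c-p\<bar> < sqrt (p\<^sup>2-k)" by (intro real_less_rsqrt) simp
  then show "p - sqrt (p\<^sup>2 - k) < c" "c < p + sqrt (p\<^sup>2 - k)" by auto
  show "p\<^sup>2 - k > 0" using h zero_le_power2[of "c-p"] by linarith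
qed

text \<open>The first law confines \<open>(y, z)\<close> and the second \<open>(x, z)\<close> to an
  ellipse, with maximal \<open>z^2\<close> equal to \<open>a^2 / (1-u^2)\<close> and
  \<open>b^2 / (1-v^2)\<close>. The path runs on the ellipse with the lower maximum, so the
  remaining coordinate can always be taken as the smaller root of the other law.\<close>

lemma p3p_exists_ordered:
  fixes a b c u v w :: real
  assumes pos: "b > 0" "c > 0" and ab: "b \<le> a"
    and law1: "a\<^sup>2 = b\<^sup>2 + c\<^sup>2 - 2*b*c*c1" and law2: "b\<^sup>2 = a\<^sup>2 + c\<^sup>2 - 2*a*c*c2"
    and u: "u > c1" "u\<^sup>2 < 1" and v: "v > c2" "v\<^sup>2 < 1"
  shows "\<exists>x>0. \<exists>y>0. \<exists>z>0. p3p a b c u v w x y z"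
proof -
  have a: "a > 0" using pos ab by simp
  have ab2: "a\<^sup>2 \<ge> b\<^sup>2" using ab pos by (simp add: power_mono)
  \<comment> \<open>The side \<open>b\<close> does not exceed \<open>a\<close>, so the angle
    opposite to \<open>b\<close> is acute.\<close>
  have c2: "c2 > 0"
  proof -
    have "2*a*c*c2 > 0" using law2 ab2 pos by (smt (verit) zero_less_power2)
    moreover have "2*a*c > 0" using a pos by simp
    ultimately show ?thesis by (rule zero_less_mult_pos)
  qed
  then have v0: "v > 0" using v by simp
  have v1: "v\<^sup>2 > c2\<^sup>2" using v c2 by (simp add: power_strict_mono)
  \<comment> \<open>The law of sines, squared: multiplied by \<open>4*c^2\<close>, both sides are
    sixteen times the squared area.\<close>
  have sine: "b\<^sup>2*(1-c1\<^sup>2) = a\<^sup>2*(1-c2\<^sup>2)"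
  proof -
    have k: "2*b*c*c1 = b\<^sup>2 + c\<^sup>2 - a\<^sup>2" "2*a*c*c2 = a\<^sup>2 + c\<^sup>2 - b\<^sup>2"
      using law1 law2 by simp_all
    have "4*c\<^sup>2 * (b\<^sup>2*(1-c1\<^sup>2)) = 4*b\<^sup>2*c\<^sup>2 - (2*b*c*c1)\<^sup>2"
      by (simp add: power2_eq_square algebra_simps)
    also have "\<dots> = 4*a\<^sup>2*c\<^sup>2 - (2*a*c*c2)\<^sup>2"
      unfolding k by (simp add: power2_eq_square algebra_simps)
    also have "\<dots> = 4*c\<^sup>2 * (a\<^sup>2*(1-c2\<^sup>2))"
      by (simp add: power2_eq_square algebra_simps)
    finally have "4*c\<^sup>2 * (b\<^sup>2*(1-c1\<^sup>2)) = 4*c\<^sup>2 * (a\<^sup>2*(1-c2\<^sup>2))" .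
    then show ?thesis using pos by simp
  qed
  \<comment> \<open>Nonnegative \<open>x\<close> and \<open>y\<close> suffice: a zero turns the
    first or the second law into that of the base triangle and forces \<open>u = c1\<close> or
    \<open>v = c2\<close>.\<close>
  have finish: ?thesis
    if "x \<ge> 0" "y \<ge> 0" "z > 0" and e: "p3p a b c u v w x y z" for x y z
  proof -
    have "x \<noteq> 0"
    proof
      assume "x = 0"
      then have "z = b" "y = c" using e that pos by (auto simp: p3p_def)
      then have "2*b*c*u = 2*b*c*c1" using e law1 by (simp add: p3p_def mult.commute mult.left_commute)
      then show False using pos u by simp
    qed
    moreover have "y \<noteq> 0"
    proof
      assume "y = 0"
      then have "z = a" "x = c" using e that pos a by (auto simp: p3p_def)
      then have "2*a*c * v = 2*a*c*c2" using e law2 by (simp add: p3p_def mult.commute mult.left_commute)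
      then show False using pos a v by simp
    qed
    ultimately show ?thesis using that by (metis order_le_less)
  qed
  \<comment> \<open>These two inequalities locate the ends of the paths. At \<open>y = 0\<close>,
    \<open>z = a\<close> the second law is a quadratic in \<open>x\<close>; at \<open>x = 0\<close>,
    \<open>z = b\<close> the first is a quadratic in \<open>y\<close>. Since \<open>v > c2\<close>
    and \<open>u > c1\<close>, both have \<open>c\<close> between their roots.\<close>
  have fa: "c\<^sup>2 - 2*c*(a * v) + (a\<^sup>2-b\<^sup>2) < 0"
  proof -
    have "c\<^sup>2 - 2*c*(a * v) + (a\<^sup>2-b\<^sup>2) = 2*a*c*(c2 - v)" using law2 by (simp add: algebra_simps)
    also have "\<dots> < 0" using a pos v by (simp add: mult_pos_neg)
    finally show ?thesis .
  qed
  have fb: "c\<^sup>2 - 2*c*(b*u) + (b\<^sup>2-a\<^sup>2) < 0"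
  proof -
    have "c\<^sup>2 - 2*c*(b*u) + (b\<^sup>2-a\<^sup>2) = 2*b*c*(c1 - u)" using law1 by (simp add: algebra_simps)
    also have "\<dots> < 0" using pos u by (simp add: mult_pos_neg)
    finally show ?thesis .
  qed
  define xm where "xm = a * v - sqrt (b\<^sup>2 - a\<^sup>2*(1-v\<^sup>2))"
  define xp where "xp = a * v + sqrt (b\<^sup>2 - a\<^sup>2*(1-v\<^sup>2))"
  have eqa: "b\<^sup>2 - a\<^sup>2*(1-v\<^sup>2) = (a * v)\<^sup>2 - (a\<^sup>2-b\<^sup>2)" by (simp add: power_mult_distrib algebra_simps)
  have xb: "xm < c" "c < xp" "b\<^sup>2 - a\<^sup>2*(1-v\<^sup>2) > 0"
    unfolding xm_def xp_def eqa using between_roots[OF fa] by auto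
  have xm: "xm \<ge> 0" "xm\<^sup>2 + a\<^sup>2 - 2*xm*a * v = b\<^sup>2"
    using minus_root[OF v0 ab pos(1)] xb(3) by (auto simp: xm_def)
  have xp: "xp \<ge> 0" "xp\<^sup>2 + a\<^sup>2 - 2*xp*a * v = b\<^sup>2"
  proof -
    show "xp \<ge> 0" using xb pos by simp
    have e: "xp = 2*a * v - xm" by (simp add: xp_def xm_def)
    then show "xp\<^sup>2 + a\<^sup>2 - 2*xp*a * v = b\<^sup>2" unfolding xm(2)[symmetric] e by (simp add: power2_eq_square algebra_simps)
  qed
  show ?thesis
  proof (cases "a\<^sup>2*(1-v\<^sup>2) \<le> b\<^sup>2*(1-u\<^sup>2)")
    \<comment> \<open>Path on the first ellipse from \<open>(y1, b)\<close>, where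
      \<open>x = 0\<close> and \<open>y1 > c\<close>, to \<open>(0, a)\<close>, where
      \<open>x = xm < c\<close>.\<close>
    case True
    define y1 where "y1 = b*u + sqrt ((b*u)\<^sup>2 - (b\<^sup>2-a\<^sup>2))"
    have y1: "c < y1" "y1\<^sup>2 + b\<^sup>2 - 2*y1*b*u = a\<^sup>2"
    proof -
      show "c < y1" using between_roots[OF fb] by (simp add: y1_def)
      have "(y1 - b*u)\<^sup>2 = (b*u)\<^sup>2 - (b\<^sup>2-a\<^sup>2)" using between_roots(3)[OF fb] by (simp add: y1_def)
      then show "y1\<^sup>2 + b\<^sup>2 - 2*y1*b*u = a\<^sup>2" by (simp add: power2_eq_square algebra_simps)
    qed
    have pr: "0\<^sup>2 + a\<^sup>2 - 2*0*a*u = a\<^sup>2" "0 \<le> y1" "0 \<le> (0::real)" "b \<le> b" "b \<le> a"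
      using y1(1) pos ab by auto
    obtain Y Z :: "real \<Rightarrow> real" where Y: "continuous_on {0..1} Y" and Z: "continuous_on {0..1} Z"
      and YZ: "Y 0 = y1" "Z 0 = b" "Y 1 = 0" "Z 1 = a"
      and on': "\<forall>s\<in>{0..1}. (Y s)\<^sup>2 + (Z s)\<^sup>2 - 2 * Y s * Z s * u = a\<^sup>2 \<and> Y s \<ge> 0 \<and> Z s \<ge> b"
      using conic_path[OF u(2) a pos(1) y1(2) pr] by blast
    note on = bspec[OF on']
    define X where "X = (\<lambda>s. Z s * v - sqrt (b\<^sup>2 - (Z s)\<^sup>2*(1-v\<^sup>2)))"
    have X: "X s \<ge> 0" "(X s)\<^sup>2 + (Z s)\<^sup>2 - 2 * X s * Z s * v = b\<^sup>2" if s: "s \<in> {0..1}" for s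
    proof -
      have "(Z s)\<^sup>2 * (1-u\<^sup>2) = a\<^sup>2 - (Y s - Z s * u)\<^sup>2"
        using on[OF s] by (simp add: power2_eq_square algebra_simps)
      then have "(Z s)\<^sup>2 * (1-u\<^sup>2) \<le> a\<^sup>2" by simp
      then have "(Z s)\<^sup>2 * (1-u\<^sup>2) * (1-v\<^sup>2) \<le> a\<^sup>2 * (1-v\<^sup>2)" using v by (intro mult_right_mono) auto
      then have "(1-u\<^sup>2) * ((Z s)\<^sup>2 * (1-v\<^sup>2)) \<le> (1-u\<^sup>2) * b\<^sup>2" using True by (simp add: mult_ac)
      then have "(Z s)\<^sup>2 * (1-v\<^sup>2) \<le> b\<^sup>2" using u by simp
      then show "X s \<ge> 0" "(X s)\<^sup>2 + (Z s)\<^sup>2 - 2 * X s * Z s * v = b\<^sup>2"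
        using minus_root[OF v0, of b "Z s"] on[OF s] pos by (auto simp: X_def)
    qed
    have X01: "X 0 = 0" "X 1 = xm"
    proof -
      have "b\<^sup>2 - b\<^sup>2*(1-v\<^sup>2) = (b * v)\<^sup>2" by (simp add: power_mult_distrib algebra_simps)
      then show "X 0 = 0" using YZ v0 pos by (simp add: X_def)
      show "X 1 = xm" using YZ by (simp add: X_def xm_def)
    qed
    define g where "g = (\<lambda>s. (X s)\<^sup>2 + (Y s)\<^sup>2 - 2 * X s * Y s * w)"
    have cg: "continuous_on {0..1} g"
      unfolding g_def X_def using Y Z by (intro continuous_intros)
    have "g 1 \<le> c\<^sup>2" "c\<^sup>2 \<le> g 0" using X01 YZ xm xb y1 pos by (auto simp: g_def power_mono)
    then obtain s where s: "0 \<le> s" "s \<le> 1" "g s = c\<^sup>2"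
      using IVT2'[of g 1 "c\<^sup>2" 0] cg by auto
    then have "p3p a b c u v w (X s) (Y s) (Z s)"
      using X on by (auto simp: p3p_def g_def)
    then show ?thesis using finish[of "X s" "Y s" "Z s"] X on[of s] s pos by auto
  next
    case False
    \<comment> \<open>If \<open>u <= 0\<close>, then \<open>c1 < u\<close> gives
      \<open>u^2 <= c1^2\<close>, and the law of sines leads back to the first case.\<close>
    have u0: "u > 0"
    proof (rule ccontr)
      assume "\<not> u > 0"
      then have "u\<^sup>2 \<le> c1\<^sup>2" using u by (simp add: abs_le_square_iff[symmetric])
      then have "b\<^sup>2*(1-c1\<^sup>2) \<le> b\<^sup>2*(1-u\<^sup>2)" by (intro mult_left_mono) auto
      moreover have "a\<^sup>2*(1-v\<^sup>2) \<le> a\<^sup>2*(1-c2\<^sup>2)" using v1 by (intro mult_left_mono) auto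
      ultimately show False using False sine by simp
    qed
    \<comment> \<open>Path on the second ellipse from \<open>(xm, a)\<close> to
      \<open>(xp, a)\<close>: both ends have \<open>y = 0\<close>, and
      \<open>xm < c < xp\<close>.\<close>
    obtain X Z :: "real \<Rightarrow> real" where X: "continuous_on {0..1} X" and Z: "continuous_on {0..1} Z"
      and XZ: "X 0 = xm" "Z 0 = a" "X 1 = xp" "Z 1 = a"
      and on': "\<forall>s\<in>{0..1}. (X s)\<^sup>2 + (Z s)\<^sup>2 - 2 * X s * Z s * v = b\<^sup>2 \<and> X s \<ge> 0 \<and> Z s \<ge> a"
      using conic_path[OF v(2) pos(1) a xm(2) xp(2) xm(1) xp(1) order_refl order_refl] by blast
    note on = bspec[OF on']
    define Y where "Y = (\<lambda>s. Z s * u - sqrt (a\<^sup>2 - (Z s)\<^sup>2*(1-u\<^sup>2)))"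
    have Y: "Y s \<ge> 0" "(Y s)\<^sup>2 + (Z s)\<^sup>2 - 2 * Y s * Z s * u = a\<^sup>2" if s: "s \<in> {0..1}" for s
    proof -
      have "(Z s)\<^sup>2 * (1-v\<^sup>2) = b\<^sup>2 - (X s - Z s * v)\<^sup>2"
        using on[OF s] by (simp add: power2_eq_square algebra_simps)
      then have "(Z s)\<^sup>2 * (1-v\<^sup>2) \<le> b\<^sup>2" by simp
      then have "(Z s)\<^sup>2 * (1-v\<^sup>2) * (1-u\<^sup>2) \<le> b\<^sup>2 * (1-u\<^sup>2)" using u by (intro mult_right_mono) auto
      then have "(1-v\<^sup>2) * ((Z s)\<^sup>2 * (1-u\<^sup>2)) \<le> (1-v\<^sup>2) * a\<^sup>2" using False by (simp add: mult_ac)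
      then have "(Z s)\<^sup>2 * (1-u\<^sup>2) \<le> a\<^sup>2" using v by simp
      then show "Y s \<ge> 0" "(Y s)\<^sup>2 + (Z s)\<^sup>2 - 2 * Y s * Z s * u = a\<^sup>2"
        using minus_root[OF u0, of a "Z s"] on[OF s] a by (auto simp: Y_def)
    qed
    have Y01: "Y 0 = 0" "Y 1 = 0"
    proof -
      have "a\<^sup>2 - a\<^sup>2*(1-u\<^sup>2) = (a*u)\<^sup>2" by (simp add: power_mult_distrib algebra_simps)
      then show "Y 0 = 0" "Y 1 = 0" using XZ u0 a by (simp_all add: Y_def)
    qed
    define g where "g = (\<lambda>s. (X s)\<^sup>2 + (Y s)\<^sup>2 - 2 * X s * Y s * w)"
    have cg: "continuous_on {0..1} g"
      unfolding g_def Y_def using X Z by (intro continuous_intros)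
    have "g 0 \<le> c\<^sup>2" "c\<^sup>2 \<le> g 1" using Y01 XZ xm xb pos by (auto simp: g_def power_mono)
    then obtain s where s: "0 \<le> s" "s \<le> 1" "g s = c\<^sup>2"
      using IVT'[of g 0 "c\<^sup>2" 1] cg by auto
    then have "p3p a b c u v w (X s) (Y s) (Z s)"
      using Y on by (auto simp: p3p_def g_def)
    then show ?thesis using finish[of "X s" "Y s" "Z s"] Y on[of s] s a by auto
  qed
qed

lemma p3p_exists:
  fixes a b c u v w :: real
  assumes pos: "a > 0" "b > 0" "c > 0"
    and law1: "a\<^sup>2 = b\<^sup>2 + c\<^sup>2 - 2*b*c*c1" and law2: "b\<^sup>2 = a\<^sup>2 + c\<^sup>2 - 2*a*c*c2"
    and u: "u > c1" "u\<^sup>2 < 1" and v: "v > c2" "v\<^sup>2 < 1"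
  shows "\<exists>x>0. \<exists>y>0. \<exists>z>0. p3p a b c u v w x y z"
proof (cases "b \<le> a")
  case True
  then show ?thesis using p3p_exists_ordered assms by blast
next
  case False
  then have "a \<le> b" by simp
  from p3p_exists_ordered[OF pos(1,3) this law2 law1 v u, of w]
  obtain x y z where "x > 0" "y > 0" "z > 0" "p3p b a c v u w x y z" by (elim exE conjE)
  moreover from this have "p3p a b c u v w y x z" by (subst p3p_swap12)
  ultimately show ?thesis by auto
qed

subsection \<open>Limits of nonnegative solutions\<close>

text \<open>The inequality \<open>2*|y|*|z| <= y^2 + z^2\<close> turns the law into
  \<open>(1-k) * (y^2 + z^2) <= a^2\<close>.\<close>

lemma conic_bound:
  fixes u k a y z :: real
  assumes e: "y\<^sup>2 + z\<^sup>2 - 2*y*z*u = a\<^sup>2" and u: "\<bar>u\<bar> \<le> k" "k < 1"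
  shows "\<bar>y\<bar> \<le> \<bar>a\<bar> / sqrt (1 - k)"
proof -
  have "2*y*z*u \<le> 2*\<bar>y\<bar>*\<bar>z\<bar>*\<bar>u\<bar>"
    by (metis abs_ge_self abs_mult abs_numeral)
  also have "\<dots> \<le> 2*\<bar>y\<bar>*\<bar>z\<bar>*k" using u by (intro mult_left_mono) auto
  finally have 1: "2*y*z*u \<le> k * (2*\<bar>y\<bar>*\<bar>z\<bar>)" by (simp add: mult_ac)
  have "0 \<le> (\<bar>y\<bar> - \<bar>z\<bar>)\<^sup>2" by simp
  then have "2*\<bar>y\<bar>*\<bar>z\<bar> \<le> y\<^sup>2 + z\<^sup>2" by (simp add: power2_eq_square algebra_simps)
  moreover have "k \<ge> 0" using u by linarith
  ultimately have "k * (2*\<bar>y\<bar>*\<bar>z\<bar>) \<le> k * (y\<^sup>2 + z\<^sup>2)" by (intro mult_left_mono)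
  then have "(1-k) * y\<^sup>2 + (1-k) * z\<^sup>2 \<le> a\<^sup>2" using 1 e by (simp add: algebra_simps)
  moreover have "(1-k) * z\<^sup>2 \<ge> 0" using u by simp
  ultimately have "(1-k) * y\<^sup>2 \<le> a\<^sup>2" by linarith
  then have "y\<^sup>2 \<le> a\<^sup>2 / (1-k)" using u by (simp add: field_simps)
  then have "sqrt (y\<^sup>2) \<le> sqrt (a\<^sup>2 / (1-k))" by (rule real_sqrt_le_mono)
  then show ?thesis by (simp add: real_sqrt_divide)
qed

lemma p3p_bound:
  assumes "p3p a b c u v w x y z" "\<bar>u\<bar> \<le> k" "\<bar>v\<bar> \<le> k" "k < 1"
  shows "norm (x,y,z) \<le> (\<bar>a\<bar> + \<bar>a\<bar> + \<bar>b\<bar>) / sqrt (1-k)"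
proof -
  have y: "\<bar>y\<bar> \<le> \<bar>a\<bar> / sqrt (1 - k)"
    using conic_bound[of y z u a k] assms by (simp add: p3p_def)
  have z: "\<bar>z\<bar> \<le> \<bar>a\<bar> / sqrt (1 - k)"
    using conic_bound[of z y u a k] assms by (simp add: p3p_def mult_ac add_ac)
  have x: "\<bar>x\<bar> \<le> \<bar>b\<bar> / sqrt (1 - k)"
    using conic_bound[of x z v b k] assms by (simp add: p3p_def)
  have "norm (x,y,z) \<le> norm x + norm (y,z)" by (rule norm_Pair_le)
  also have "\<dots> \<le> norm x + (norm y + norm z)" by (intro add_left_mono norm_Pair_le)
  also have "\<dots> \<le> \<bar>b\<bar> / sqrt (1 - k) + (\<bar>a\<bar> / sqrt (1 - k) + \<bar>a\<bar> / sqrt (1 - k))"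
    using x y z by (intro add_mono) auto
  also have "\<dots> = (\<bar>a\<bar> + \<bar>a\<bar> + \<bar>b\<bar>) / sqrt (1-k)" by (simp add: add_divide_distrib)
  finally show ?thesis .
qed

text \<open>The first two laws contain all three distances, so once \<open>|U n|\<close> and
  \<open>|V n|\<close> stay below a fixed \<open>k < 1\<close> the solutions are bounded, and a
  convergent subsequence exists.\<close>

lemma p3p_limit:
  fixes U V W X Y Z :: "nat \<Rightarrow> real"
  assumes lim: "U \<longlonglongrightarrow> u" "V \<longlonglongrightarrow> v" "W \<longlonglongrightarrow> w" and uv: "\<bar>u\<bar> < 1" "\<bar>v\<bar> < 1"
    and sol: "\<And>n. X n \<ge> 0 \<and> Y n \<ge> 0 \<and> Z n \<ge> 0 \<and> p3p a b c (U n) (V n) (W n) (X n) (Y n) (Z n)"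
  obtains r x y z where "strict_mono (r :: nat \<Rightarrow> nat)" "(X \<circ> r) \<longlonglongrightarrow> x" "(Y \<circ> r) \<longlonglongrightarrow> y" "(Z \<circ> r) \<longlonglongrightarrow> z"
    "x \<ge> 0" "y \<ge> 0" "z \<ge> 0" "p3p a b c u v w x y z"
proof -
  obtain k where k: "\<bar>u\<bar> < k" "\<bar>v\<bar> < k" "k < 1"
    using dense[of "max \<bar>u\<bar> \<bar>v\<bar>" 1] uv by auto
  have "eventually (\<lambda>n. \<bar>U n\<bar> < k) sequentially" "eventually (\<lambda>n. \<bar>V n\<bar> < k) sequentially"
    using order_tendstoD(2)[OF tendsto_rabs[OF lim(1)] k(1)] order_tendstoD(2)[OF tendsto_rabs[OF lim(2)] k(2)] .
  then have "eventually (\<lambda>n. \<bar>U n\<bar> < k \<and> \<bar>V n\<bar> < k) sequentially" by eventually_elim auto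
  then obtain N where N: "\<And>n. n \<ge> N \<Longrightarrow> \<bar>U n\<bar> < k \<and> \<bar>V n\<bar> < k"
    unfolding eventually_sequentially by blast
  have "bounded (range (\<lambda>n. (X (n+N), Y (n+N), Z (n+N))))"
    unfolding bounded_iff
  proof (intro exI ballI)
    fix p assume "p \<in> range (\<lambda>n. (X (n+N), Y (n+N), Z (n+N)))"
    then obtain n where p: "p = (X (n+N), Y (n+N), Z (n+N))" by blast
    show "norm p \<le> (\<bar>a\<bar> + \<bar>a\<bar> + \<bar>b\<bar>) / sqrt (1-k)"
      unfolding p using N[of "n+N"] sol[of "n+N"] k(3)
      by (intro p3p_bound[of a b c "U (n+N)" "V (n+N)" "W (n+N)"]) auto
  qed
  then obtain l s where s: "strict_mono s" "((\<lambda>n. (X (n+N), Y (n+N), Z (n+N))) \<circ> s) \<longlonglongrightarrow> l"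
    using bounded_imp_convergent_subsequence by blast
  define r where "r = (\<lambda>n. s n + N)"
  obtain x y z where l: "l = (x,y,z)" by (cases l) auto
  have r: "strict_mono r" using s(1) by (auto simp: r_def strict_mono_def)
  have t: "(\<lambda>n. (X (r n), Y (r n), Z (r n))) \<longlonglongrightarrow> (x,y,z)"
    using s(2) by (simp add: o_def r_def l)
  have tX: "(\<lambda>n. X (r n)) \<longlonglongrightarrow> x" using tendsto_fst[OF t] by simp
  have tY: "(\<lambda>n. Y (r n)) \<longlonglongrightarrow> y" using tendsto_fst[OF tendsto_snd[OF t]] by simp
  have tZ: "(\<lambda>n. Z (r n)) \<longlonglongrightarrow> z" using tendsto_snd[OF tendsto_snd[OF t]] by simp
  have tU: "(\<lambda>n. U (r n)) \<longlonglongrightarrow> u" "(\<lambda>n. V (r n)) \<longlonglongrightarrow> v" "(\<lambda>n. W (r n)) \<longlonglongrightarrow> w"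
    using lim[THEN LIMSEQ_subseq_LIMSEQ, OF r] by (auto simp: o_def)
  have "(\<lambda>n. (Y (r n))\<^sup>2 + (Z (r n))\<^sup>2 - 2 * Y (r n) * Z (r n) * U (r n)) \<longlonglongrightarrow> y\<^sup>2 + z\<^sup>2 - 2*y*z*u"
    by (intro tendsto_intros tX tY tZ tU)
  then have "(\<lambda>n. a\<^sup>2) \<longlonglongrightarrow> y\<^sup>2 + z\<^sup>2 - 2*y*z*u" using sol by (simp add: p3p_def)
  then have e1: "y\<^sup>2 + z\<^sup>2 - 2*y*z*u = a\<^sup>2" by (simp add: LIMSEQ_const_iff)
  have "(\<lambda>n. (X (r n))\<^sup>2 + (Z (r n))\<^sup>2 - 2 * X (r n) * Z (r n) * V (r n)) \<longlonglongrightarrow> x\<^sup>2 + z\<^sup>2 - 2*x*z * v"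
    by (intro tendsto_intros tX tY tZ tU)
  then have "(\<lambda>n. b\<^sup>2) \<longlonglongrightarrow> x\<^sup>2 + z\<^sup>2 - 2*x*z * v" using sol by (simp add: p3p_def)
  then have e2: "x\<^sup>2 + z\<^sup>2 - 2*x*z * v = b\<^sup>2" by (simp add: LIMSEQ_const_iff)
  have "(\<lambda>n. (X (r n))\<^sup>2 + (Y (r n))\<^sup>2 - 2 * X (r n) * Y (r n) * W (r n)) \<longlonglongrightarrow> x\<^sup>2 + y\<^sup>2 - 2*x*y*w"
    by (intro tendsto_intros tX tY tZ tU)
  then have "(\<lambda>n. c\<^sup>2) \<longlonglongrightarrow> x\<^sup>2 + y\<^sup>2 - 2*x*y*w" using sol by (simp add: p3p_def)
  then have e3: "x\<^sup>2 + y\<^sup>2 - 2*x*y*w = c\<^sup>2" by (simp add: LIMSEQ_const_iff)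
  show ?thesis
  proof (rule that[OF r])
    show "(X \<circ> r) \<longlonglongrightarrow> x" "(Y \<circ> r) \<longlonglongrightarrow> y" "(Z \<circ> r) \<longlonglongrightarrow> z" using tX tY tZ by (auto simp: o_def)
    show "x \<ge> 0" "y \<ge> 0" "z \<ge> 0" using sol
      by (auto intro: LIMSEQ_le_const[OF tX] LIMSEQ_le_const[OF tY] LIMSEQ_le_const[OF tZ])
    show "p3p a b c u v w x y z" using e1 e2 e3 by (simp add: p3p_def)
  qed
qed

text \<open>The Gram determinant of three unit vectors with pairwise inner products \<open>u, v, w\<close>.\<close>

definition gram :: "real \<Rightarrow> real \<Rightarrow> real \<Rightarrow> real" where
  "gram u v w = 1 + 2*u * v * w - u\<^sup>2 - v\<^sup>2 - w\<^sup>2"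

text \<open>Solutions are only required to be nonnegative because this is what the closure
  \<open>CFT\<close> provides: distances may tend to zero in the limit.\<close>

definition p3p_near :: "real \<Rightarrow> real \<Rightarrow> real \<Rightarrow> real \<Rightarrow> real \<Rightarrow> real \<Rightarrow> bool" where
  "p3p_near a b c u v w \<longleftrightarrow> (\<exists>e>0. \<forall>u' v' w'. \<bar>u'-u\<bar> < e \<and> \<bar>v'-v\<bar> < e \<and> \<bar>w'-w\<bar> < e \<longrightarrow>
     (\<exists>x\<ge>0. \<exists>y\<ge>0. \<exists>z\<ge>0. p3p a b c u' v' w' x y z))"

lemma p3p_near_swap12: "p3p_near a b c u v w \<Longrightarrow> p3p_near b a c v u w"
  unfolding p3p_near_def by (subst (asm) p3p_swap12) fast

lemma p3p_near_swap23: "p3p_near a b c u v w \<Longrightarrow> p3p_near a c b u w v"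
  unfolding p3p_near_def by (subst (asm) p3p_swap23) fast

text \<open>
  Solutions for points that approach \<open>(u, v, w)\<close> along the ray in the direction \<open>(d1, d2, d3)\<close>,
  converging to a solution for \<open>(u, v, w)\<close>.
\<close>

definition approach where
  "approach a b c u v w d1 d2 d3 T X Y Z x y z \<longleftrightarrow>
    (\<forall>n::nat. T n > (0::real) \<and> X n \<ge> 0 \<and> Y n \<ge> 0 \<and> Z n \<ge> 0 \<and>
       p3p a b c (u + T n * d1) (v + T n * d2) (w + T n * d3) (X n) (Y n) (Z n)) \<and>
    T \<longlonglongrightarrow> 0 \<and> X \<longlonglongrightarrow> x \<and> Y \<longlonglongrightarrow> y \<and> Z \<longlonglongrightarrow> z \<and>
    x \<ge> 0 \<and> y \<ge> 0 \<and> z \<ge> 0 \<and> p3p a b c u v w x y z"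

lemma approach_swap12: "approach a b c u v w d1 d2 d3 T X Y Z x y z \<Longrightarrow> approach b a c v u w d2 d1 d3 T Y X Z y x z"
  unfolding approach_def by (auto simp: p3p_swap12[of a b])

lemma approach_swap23: "approach a b c u v w d1 d2 d3 T X Y Z x y z \<Longrightarrow> approach a c b u w v d1 d3 d2 T X Z Y x z y"
  unfolding approach_def by (auto simp: p3p_swap23[of a b c])

lemma approach_exists:
  fixes a b c u v w d1 d2 d3 :: real
  assumes near: "p3p_near a b c u v w" and uv: "\<bar>u\<bar> < 1" "\<bar>v\<bar> < 1"
  obtains T X Y Z x y z where "approach a b c u v w d1 d2 d3 T X Y Z x y z"
proof -
  obtain e where e: "e > 0" and sol: "\<And>u' v' w'. \<bar>u'-u\<bar> < e \<Longrightarrow> \<bar>v'-v\<bar> < e \<Longrightarrow> \<bar>w'-w\<bar> < e \<Longrightarrow>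
     \<exists>x\<ge>0. \<exists>y\<ge>0. \<exists>z\<ge>0. p3p a b c u' v' w' x y z"
    using near unfolding p3p_near_def by metis
  define D where "D = \<bar>d1\<bar> + \<bar>d2\<bar> + \<bar>d3\<bar> + 1"
  \<comment> \<open>Scaled so that every term, including the one for \<open>n = 0\<close>, moves
    each coordinate by less than \<open>e\<close>; the double \<open>Suc\<close> keeps the factor
    strictly below 1.\<close>
  define T where "T = (\<lambda>n::nat. (e/D) * inverse (real (Suc (Suc n))))"
  have D: "D > 0" by (simp add: D_def add_nonneg_pos)
  have Tpos: "T n > 0" for n using e D by (simp add: T_def)
  have T0: "T \<longlonglongrightarrow> 0"
  proof -
    have "(\<lambda>n. inverse (real (Suc n))) \<longlonglongrightarrow> 0" by (rule LIMSEQ_inverse_real_of_nat)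
    then have "(\<lambda>n. inverse (real (Suc (Suc n)))) \<longlonglongrightarrow> 0" by (rule LIMSEQ_Suc)
    then have "T \<longlonglongrightarrow> (e/D) * 0" unfolding T_def by (rule tendsto_mult_left)
    then show ?thesis by simp
  qed
  have Td: "\<bar>T n * d\<bar> < e" if "\<bar>d\<bar> \<le> D" for n d
  proof -
    have "T n < (e/D) * 1" unfolding T_def using e D by (intro mult_strict_left_mono) (auto simp: field_simps)
    then have "T n * D < e" using D by (simp add: field_simps)
    moreover have "\<bar>T n * d\<bar> \<le> T n * D" using Tpos[of n] that by (simp add: abs_mult)
    ultimately show ?thesis by linarith
  qed
  have "\<exists>x\<ge>0. \<exists>y\<ge>0. \<exists>z\<ge>0. p3p a b c (u + T n * d1) (v + T n * d2) (w + T n * d3) x y z" for n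
    by (rule sol) (use Td[of d1 n] Td[of d2 n] Td[of d3 n] in \<open>auto simp: D_def\<close>)
  then obtain X Y Z where XYZ: "\<And>n. X n \<ge> 0 \<and> Y n \<ge> 0 \<and> Z n \<ge> 0 \<and>
      p3p a b c (u + T n * d1) (v + T n * d2) (w + T n * d3) (X n) (Y n) (Z n)"
    by metis
  have l: "(\<lambda>n. u + T n * d1) \<longlonglongrightarrow> u" "(\<lambda>n. v + T n * d2) \<longlonglongrightarrow> v" "(\<lambda>n. w + T n * d3) \<longlonglongrightarrow> w"
    by (auto intro!: tendsto_eq_intros T0)
  obtain r x y z where r: "strict_mono (r :: nat \<Rightarrow> nat)" "(X \<circ> r) \<longlonglongrightarrow> x" "(Y \<circ> r) \<longlonglongrightarrow> y" "(Z \<circ> r) \<longlonglongrightarrow> z"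
    "x \<ge> 0" "y \<ge> 0" "z \<ge> 0" "p3p a b c u v w x y z"
    using p3p_limit[OF l uv XYZ] .
  have "approach a b c u v w d1 d2 d3 (T \<circ> r) (X \<circ> r) (Y \<circ> r) (Z \<circ> r) x y z"
    unfolding approach_def using r XYZ Tpos LIMSEQ_subseq_LIMSEQ[OF T0 r(1)] by auto
  then show ?thesis by (rule that)
qed

subsection \<open>Positive solutions at interior points\<close>

definition tri :: "real \<Rightarrow> real \<Rightarrow> real \<Rightarrow> real \<Rightarrow> real \<Rightarrow> real \<Rightarrow> bool" where
  "tri a b c c1 c2 c3 \<longleftrightarrow> a > 0 \<and> b > 0 \<and> c > 0 \<and> c1\<^sup>2 < 1 \<and> c2\<^sup>2 < 1 \<and> c3\<^sup>2 < 1 \<and>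
     a\<^sup>2 = b\<^sup>2 + c\<^sup>2 - 2*b*c*c1 \<and> b\<^sup>2 = a\<^sup>2 + c\<^sup>2 - 2*a*c*c2 \<and> c\<^sup>2 = a\<^sup>2 + b\<^sup>2 - 2*a*b*c3"

lemma triD:
  assumes "tri a b c c1 c2 c3"
  shows "a > 0" "b > 0" "c > 0" "c1\<^sup>2 < 1" "c2\<^sup>2 < 1" "c3\<^sup>2 < 1"
    "a\<^sup>2 = b\<^sup>2 + c\<^sup>2 - 2*b*c*c1" "b\<^sup>2 = a\<^sup>2 + c\<^sup>2 - 2*a*c*c2" "c\<^sup>2 = a\<^sup>2 + b\<^sup>2 - 2*a*b*c3"
  using assms unfolding tri_def by blast+

lemma tri_swap12:
  assumes "tri a b c c1 c2 c3"
  shows "tri b a c c2 c1 c3"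
proof -
  have "c\<^sup>2 = b\<^sup>2 + a\<^sup>2 - 2*b*a*c3" using triD(9)[OF assms] by (simp add: ac_simps)
  then show ?thesis using triD[OF assms] unfolding tri_def by blast
qed

lemma tri_swap23:
  assumes "tri a b c c1 c2 c3"
  shows "tri a c b c1 c3 c2"
proof -
  have "a\<^sup>2 = c\<^sup>2 + b\<^sup>2 - 2*c*b*c1" using triD(7)[OF assms] by (simp add: ac_simps)
  then show ?thesis using triD[OF assms] unfolding tri_def by blast
qed

text \<open>Each side is the sum of the signed projections of the other two; this is the sum of two
  cosine laws, divided by twice the side.\<close>

lemma tri_projection:
  assumes "tri a b c c1 c2 c3"
  shows "a = b*c3 + c*c2" "b = a*c3 + c*c1" "c = a*c2 + b*c1"
proof -
  note l = triD(7-9)[OF assms]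
  have "a*(2*a) = a*(2*(b*c3 + c*c2))"
    using l(2,3) by (simp add: power2_eq_square algebra_simps)
  then show "a = b*c3 + c*c2" using triD(1)[OF assms] by simp
  have "b*(2*b) = b*(2*(a*c3 + c*c1))"
    using l(1,3) by (simp add: power2_eq_square algebra_simps)
  then show "b = a*c3 + c*c1" using triD(2)[OF assms] by simp
  have "c*(2*c) = c*(2*(a*c2 + b*c1))"
    using l(1,2) by (simp add: power2_eq_square algebra_simps)
  then show "c = a*c2 + b*c1" using triD(3)[OF assms] by simp
qed

text \<open>This is the identity \<open>c1^2 + c2^2 + c3^2 + 2*c1*c2*c3 = 1\<close> for the cosines
  of three angles with sum \<pi>, obtained here by eliminating the sides.\<close>

lemma tri_gram:
  assumes "tri a b c c1 c2 c3"
  shows "gram c1 c2 c3 = 4*c1*c2*c3"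
proof -
  have "a * (c1\<^sup>2 + c2\<^sup>2 + c3\<^sup>2 + 2*c1*c2*c3 - 1) = 0"
    using tri_projection[OF assms] by algebra
  then show ?thesis using triD(1)[OF assms] by (simp add: gram_def)
qed

lemma tri_nonacute:
  assumes "tri a b c c1 c2 c3" "c2 \<le> 0"
  shows "c1 > 0" "c3 > 0"
proof -
  note p = triD(1-3)[OF assms(1)]
  have "c * c2 \<le> 0" "a * c2 \<le> 0" using assms(2) p by (simp_all add: mult_nonneg_nonpos)
  then have "b * c3 > 0" "b * c1 > 0" using tri_projection[OF assms(1)] p by linarith+
  then show "c1 > 0" "c3 > 0" using p(2) by (simp_all add: zero_less_mult_iff)
qed

text \<open>As a quadratic in \<open>w\<close>, \<open>gram c1 c2 w\<close> has the roots
  \<open>- c3\<close> and \<open>2*c1*c2 + c3\<close> and is positive only between them. The first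
  root is the smaller one, because \<open>c3 + c1*c2\<close> is the product of the sines of the
  angles at \<open>A\<close> and \<open>B\<close>.\<close>

lemma tri_gram_third:
  assumes t: "tri a b c c1 c2 c3" and g: "gram c1 c2 w > 0"
  shows "w + c3 > 0"
proof (rule ccontr)
  assume n: "\<not> w + c3 > 0"
  have e1: "b*c1 = c - a*c2" using tri_projection(3)[OF t] by linarith
  have e3: "b*c3 = a - c*c2" using tri_projection(1)[OF t] by linarith
  have "b*c3 + (b*c1)*c2 = a - c*c2 + (c - a*c2)*c2" unfolding e1 e3 ..
  then have "b*(c3 + c1*c2) = a*(1 - c2\<^sup>2)" by (simp add: power2_eq_square algebra_simps)
  also have "\<dots> > 0" using triD(1,5)[OF t] by simp
  finally have s: "c3 + c1*c2 > 0" using triD(2)[OF t] by (simp add: zero_less_mult_iff)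
  have "gram c1 c2 w = (w + c3)*(2*c1*c2 + c3 - w) + gram c1 c2 c3 - 4*c1*c2*c3"
    by (simp add: gram_def power2_eq_square algebra_simps)
  also have "\<dots> = (w + c3)*(2*c1*c2 + c3 - w)" using tri_gram[OF t] by simp
  also have "\<dots> \<le> 0" using n s by (intro mult_nonpos_nonneg) auto
  finally show False using g by simp
qed

section \<open>Solutions with a vanishing coordinate\<close>

lemma p3p_x0:
  assumes "tri a b c c1 c2 c3" "p3p a b c u v w 0 y z" "y \<ge> 0" "z \<ge> 0"
  shows "y = c" "z = b" "u = c1"
proof -
  note p = triD(2,3)[OF assms(1)] and l = triD(7)[OF assms(1)]
  have e: "y\<^sup>2 + z\<^sup>2 - 2*y*z*u = a\<^sup>2" "z\<^sup>2 = b\<^sup>2" "y\<^sup>2 = c\<^sup>2"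
    using assms(2) unfolding p3p_def by auto
  show y: "y = c" by (rule power2_eq_imp_eq[OF e(3) assms(3) less_imp_le[OF p(2)]])
  show z: "z = b" by (rule power2_eq_imp_eq[OF e(2) assms(4) less_imp_le[OF p(1)]])
  have "2*b*c*u = 2*b*c*c1" 
  proof -
    have "c\<^sup>2 + b\<^sup>2 - 2*c*b*u = b\<^sup>2 + c\<^sup>2 - 2*b*c*c1" using e(1) unfolding y z l .
    moreover have "2*c*b*u = 2*b*c*u" by simp
    ultimately show ?thesis by linarith
  qed
  then show "u = c1" using p by simp
qed

lemma p3p_y0:
  assumes "tri a b c c1 c2 c3" "p3p a b c u v w x 0 z" "x \<ge> 0" "z \<ge> 0"
  shows "x = c" "z = a" "v = c2"
  by (rule p3p_x0[OF tri_swap12[OF assms(1)] p3p_swap12[THEN iffD1, OF assms(2)] assms(3,4)])+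

lemma p3p_z0:
  assumes "tri a b c c1 c2 c3" "p3p a b c u v w x y 0" "x \<ge> 0" "y \<ge> 0"
  shows "x = b" "y = a" "w = c3"
  by (rule p3p_y0[OF tri_swap23[OF assms(1)] p3p_swap23[THEN iffD1, OF assms(2)] assms(3,4)])+

text \<open>
  On the solution curve through \<open>x = 0\<close> with \<open>v, w\<close> fixed, \<open>du/dx\<close> is a positive multiple of
  \<open>w * c2 + v * c3\<close> at \<open>x = 0\<close>, so \<open>u - c1\<close> has the sign of this number for small \<open>x\<close>.
\<close>

lemma slope_exclude:
  assumes t: "tri a b c c1 c2 c3" and ap: "approach a b c c1 v w d1 d2 d3 T X Y Z 0 y z"
    and d: "(w*c2 + v * c3) * d1 < 0"
  shows False
proof -
  note pos = triD(1-3)[OF t] and law = triD(7)[OF t]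
  have sol: "p3p a b c (c1 + T n * d1) (v + T n * d2) (w + T n * d3) (X n) (Y n) (Z n)"
    and nn: "T n > 0" "X n \<ge> 0" "Y n \<ge> 0" "Z n \<ge> 0" for n using ap by (auto simp: approach_def)
  have lim: "T \<longlonglongrightarrow> 0" "X \<longlonglongrightarrow> 0" "Y \<longlonglongrightarrow> y" "Z \<longlonglongrightarrow> z"
    and L: "p3p a b c c1 v w 0 y z" "y \<ge> 0" "z \<ge> 0"
    using ap unfolding approach_def by blast+
  note yz = p3p_x0(1,2)[OF t L]
  \<comment> \<open>The first law minus the law of the base triangle is
    \<open>(Y-c)*(Y + c - 2*c1*Z) + (Z-b)*(Z + b - 2*c1*c)\<close> up to the term with
    \<open>T n * d1\<close>. The other two laws make \<open>Y - c\<close> and \<open>Z - b\<close>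
    multiples of \<open>X\<close>; \<open>S\<close> is the cofactor of \<open>X\<close>, written
    without dividing by \<open>X\<close>.\<close>
  define S where "S = (\<lambda>n. (2 * Y n * (w + T n * d3) - X n) * (1 - 2*c1*Z n / (Y n + c))
      + (2 * Z n * (v + T n * d2) - X n) * (1 - 2*c1*c / (Z n + b)))"
  have eq: "2 * Y n * Z n * (T n * d1) = X n * S n" for n
  proof -
    have p: "Y n + c > 0" "Z n + b > 0" using nn[of n] pos by auto
    have e: "(Y n)\<^sup>2 + (Z n)\<^sup>2 - 2*Y n*Z n*(c1 + T n*d1) = a\<^sup>2"
      "(X n)\<^sup>2 + (Z n)\<^sup>2 - 2*X n*Z n*(v + T n*d2) = b\<^sup>2"
      "(X n)\<^sup>2 + (Y n)\<^sup>2 - 2*X n*Y n*(w + T n*d3) = c\<^sup>2" using sol by (auto simp: p3p_def)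
    have Ye: "X n * (2 * Y n * (w + T n * d3) - X n) = (Y n - c) * (Y n + c)"
      and Ze: "X n * (2 * Z n * (v + T n * d2) - X n) = (Z n - b) * (Z n + b)"
      using e by (simp_all add: power2_eq_square algebra_simps)
    have "X n * S n = (X n * (2 * Y n * (w + T n * d3) - X n)) * (1 - 2*c1*Z n / (Y n + c))
      + (X n * (2 * Z n * (v + T n * d2) - X n)) * (1 - 2*c1*c / (Z n + b))"
      by (simp add: S_def algebra_simps)
    also have "\<dots> = (Y n - c) * ((Y n + c) * (1 - 2*c1*Z n / (Y n + c)))
      + (Z n - b) * ((Z n + b) * (1 - 2*c1*c / (Z n + b)))"
      unfolding Ye Ze by (simp only: mult.assoc)
    also have "(Y n + c) * (1 - 2*c1*Z n / (Y n + c)) = Y n + c - 2*c1*Z n" using p by (simp add: right_diff_distrib)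
    also have "(Z n + b) * (1 - 2*c1*c / (Z n + b)) = Z n + b - 2*c1*c" using p by (simp add: right_diff_distrib)
    finally show ?thesis using e(1) law by (simp add: power2_eq_square algebra_simps)
  qed
  have "S \<longlonglongrightarrow> (2 * y * (w + 0 * d3) - 0) * (1 - 2*c1*z / (y + c))
      + (2 * z * (v + 0 * d2) - 0) * (1 - 2*c1*c / (z + b))"
    unfolding S_def using pos yz by (intro tendsto_intros lim) auto
  also have "(2 * y * (w + 0 * d3) - 0) * (1 - 2*c1*z / (y + c))
      + (2 * z * (v + 0 * d2) - 0) * (1 - 2*c1*c / (z + b)) = 2*w*(c - c1*b) + 2 * v * (b - c1*c)"
    using yz pos by (simp add: field_simps)
  also have "\<dots> = 2*a*(w*c2 + v * c3)"
  proof -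
    have 1: "c - c1*b = a*c2" using tri_projection(3)[OF t] mult.commute[of c1 b] by linarith
    have 2: "b - c1*c = a*c3" using tri_projection(2)[OF t] mult.commute[of c1 c] by linarith
    show ?thesis unfolding 1 2 by (simp add: algebra_simps)
  qed
  finally have "(\<lambda>n. S n * d1) \<longlonglongrightarrow> 2*a*(w*c2 + v * c3) * d1" by (intro tendsto_intros)
  moreover have "2*a*(w*c2 + v * c3) * d1 < 0" using d pos by (simp add: mult_pos_neg mult.assoc)
  ultimately have "eventually (\<lambda>n. S n * d1 < 0) sequentially" by (rule order_tendstoD(2))
  then obtain n where n: "S n * d1 < 0" by (auto simp: eventually_sequentially)
  have d1: "d1 \<noteq> 0" using d by auto
  have "X n \<noteq> 0"
  proof
    assume X0: "X n = 0"
    then have "c1 + T n * d1 = c1" using p3p_x0(3)[OF t sol[of n, unfolded X0] nn(3,4)] by simp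
    then show False using d1 nn(1)[of n] by simp
  qed
  \<comment> \<open>Multiplying \<open>eq\<close> by \<open>d1\<close> gives a product that is
    nonnegative, while the limit of \<open>S\<close> makes it negative.\<close>
  then have "X n * (S n * d1) < 0" using n nn[of n] by (simp add: mult_pos_neg)
  moreover have "X n * (S n * d1) = 2 * Y n * Z n * T n * (d1 * d1)"
    using eq[of n] by (simp add: algebra_simps)
  moreover have "\<dots> \<ge> 0" using nn[of n] by simp
  ultimately show False by linarith
qed

text \<open>For \<open>0 < x < c\<close> the roots in \<open>y\<close> have the negative product
  \<open>x^2 - c^2\<close>, so exactly one of them is nonnegative, and it is positive.\<close>

lemma plus_root:
  fixes x w c :: real
  assumes x: "0 < x" "x < c" and w: "w\<^sup>2 < 1"
  shows "x * w + sqrt (c\<^sup>2 - x\<^sup>2*(1-w\<^sup>2)) > 0"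
    "x\<^sup>2 + (x * w + sqrt (c\<^sup>2 - x\<^sup>2*(1-w\<^sup>2)))\<^sup>2 - 2*x*(x * w + sqrt (c\<^sup>2 - x\<^sup>2*(1-w\<^sup>2)))*w = c\<^sup>2"
    "y \<ge> 0 \<Longrightarrow> x\<^sup>2 + y\<^sup>2 - 2*x*y*w = c\<^sup>2 \<Longrightarrow> y = x * w + sqrt (c\<^sup>2 - x\<^sup>2*(1-w\<^sup>2))"
proof -
  define t where "t = sqrt (c\<^sup>2 - x\<^sup>2*(1-w\<^sup>2))"
  have xc: "x\<^sup>2 < c\<^sup>2" using x by (intro power_strict_mono) auto
  have e: "c\<^sup>2 - x\<^sup>2*(1-w\<^sup>2) = (c\<^sup>2 - x\<^sup>2) + (x*w)\<^sup>2" by (simp add: power_mult_distrib algebra_simps)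
  have t2: "t\<^sup>2 = c\<^sup>2 - x\<^sup>2*(1-w\<^sup>2)" unfolding t_def e using xc by (intro real_sqrt_pow2) simp
  have t0: "t \<ge> 0" unfolding t_def e using xc by simp
  have "(x*w)\<^sup>2 < t\<^sup>2" unfolding t2 e using xc by simp
  then have "\<bar>x*w\<bar> < \<bar>t\<bar>" by (simp add: abs_less_iff power2_less_imp_less abs_le_square_iff flip: not_le)
  then have tt: "\<bar>x*w\<bar> < t" using t0 by simp
  have "x * w + t > 0" using tt by linarith
  moreover have "x\<^sup>2 + (x*w+t)\<^sup>2 - 2*x*(x*w+t)*w = c\<^sup>2"
  proof -
    have "x\<^sup>2 + (x*w+t)\<^sup>2 - 2*x*(x*w+t)*w = t\<^sup>2 + x\<^sup>2*(1-w\<^sup>2)"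
      by (simp add: power2_eq_square algebra_simps)
    then show ?thesis unfolding t2 by simp
  qed
  moreover have "y = x*w + t" if "y \<ge> 0" "x\<^sup>2 + y\<^sup>2 - 2*x*y*w = c\<^sup>2"
  proof -
    have "(y - x*w)\<^sup>2 = t\<^sup>2" unfolding t2 using that(2) by (simp add: power2_eq_square algebra_simps)
    then have "y - x*w = t \<or> y - x*w = - t" by (simp add: power2_eq_iff)
    then show ?thesis using tt that(1) by linarith
  qed
  ultimately show "x * w + sqrt (c\<^sup>2 - x\<^sup>2*(1-w\<^sup>2)) > 0"
    "x\<^sup>2 + (x * w + sqrt (c\<^sup>2 - x\<^sup>2*(1-w\<^sup>2)))\<^sup>2 - 2*x*(x * w + sqrt (c\<^sup>2 - x\<^sup>2*(1-w\<^sup>2)))*w = c\<^sup>2"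
    "y \<ge> 0 \<Longrightarrow> x\<^sup>2 + y\<^sup>2 - 2*x*y*w = c\<^sup>2 \<Longrightarrow> y = x * w + sqrt (c\<^sup>2 - x\<^sup>2*(1-w\<^sup>2))"
    unfolding t_def[symmetric] by blast+
qed

text \<open>For small \<open>x > 0\<close> the second and third laws determine \<open>y\<close> and
  \<open>z\<close>, and \<open>h\<close> is the error left in the first law. If there were no
  positive solution, \<open>h\<close> would have constant sign on \<open>(0, m)\<close>. Perturbing
  \<open>u\<close> to the other side of \<open>c1\<close> then requires an \<open>h\<close> of the
  opposite sign, yet the perturbed solutions have arbitrarily small positive
  \<open>x\<close>.\<close>

lemma p3p_near_single_plane:
  assumes t: "tri a b c c1 c2 c3" and near: "p3p_near a b c c1 v w"
    and vw: "v \<noteq> c2" "w \<noteq> c3" and bd: "\<bar>v\<bar> < 1" "\<bar>w\<bar> < 1"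
  shows "\<exists>x>0. \<exists>y>0. \<exists>z>0. p3p a b c c1 v w x y z"
proof (rule ccontr)
  assume H: "\<not> ?thesis"
  note pos = triD(1-3)[OF t]
  have bd2: "v\<^sup>2 < 1" "w\<^sup>2 < 1" using bd by (simp_all add: abs_square_less_1)
  have c1: "\<bar>c1\<bar> < 1" using triD(4)[OF t] by (simp add: abs_square_less_1)
  define Y0 where "Y0 = (\<lambda>x. x * w + sqrt (c\<^sup>2 - x\<^sup>2*(1-w\<^sup>2)))"
  define Z0 where "Z0 = (\<lambda>x. x * v + sqrt (b\<^sup>2 - x\<^sup>2*(1-v\<^sup>2)))"
  define h where "h = (\<lambda>x. (Y0 x)\<^sup>2 + (Z0 x)\<^sup>2 - 2 * Y0 x * Z0 x * c1 - a\<^sup>2)"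
  define m where "m = min b c"
  have m: "m > 0" using pos by (simp add: m_def)
  have h0: "h x \<noteq> 0" if x: "x \<in> {0<..<m}" for x
  proof
    assume "h x = 0"
    moreover have xx: "0 < x" "x < b" "x < c" using x by (auto simp: m_def)
    ultimately have "p3p a b c c1 v w x (Y0 x) (Z0 x)" "Y0 x > 0" "Z0 x > 0"
      using plus_root[OF xx(1,3) bd2(2)] plus_root[OF xx(1,2) bd2(1)]
      by (auto simp: p3p_def h_def Y0_def Z0_def)
    then show False using H xx by blast
  qed
  have "continuous_on {0<..<m} h"
    unfolding h_def Y0_def Z0_def by (intro continuous_intros)
  then have conn: "connected (h ` {0<..<m})" by (intro connected_continuous_image) auto
  \<comment> \<open>The image of the interval under \<open>h\<close> is connected and omits 0;
    \<open>d\<close> is chosen with the sign opposite to \<open>h\<close>.\<close>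
  have "\<exists>d\<noteq>0. \<forall>x\<in>{0<..<m}. h x * d < 0"
  proof (cases "\<exists>x\<in>{0<..<m}. h x < 0")
    case True
    then obtain x1 where x1: "x1 \<in> {0<..<m}" "h x1 < 0" by blast
    have "h x < 0" if x: "x \<in> {0<..<m}" for x
    proof (rule ccontr)
      assume n: "\<not> h x < 0"
      then have "{h x1..h x} \<subseteq> h ` {0<..<m}" by (intro connected_contains_Icc[OF conn]) (use x x1 in auto)
      then have "0 \<in> h ` {0<..<m}" using n x1 by auto
      then show False using h0 by auto
    qed
    then show ?thesis by (intro exI[of _ 1]) auto
  next
    case False
    then have "\<forall>x\<in>{0<..<m}. h x * (-1) < 0" using h0 by force
    then show ?thesis by (intro exI[of _ "-1"]) auto
  qed
  then obtain d where d: "d \<noteq> 0" "\<And>x. x \<in> {0<..<m} \<Longrightarrow> h x * d < 0" by blast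
  obtain T X Y Z x y z where ap: "approach a b c c1 v w d 0 0 T X Y Z x y z"
    using approach_exists[OF near c1 bd(1)] .
  then have lim: "X \<longlonglongrightarrow> x" and L: "x \<ge> 0" "y \<ge> 0" "z \<ge> 0" "p3p a b c c1 v w x y z"
    by (auto simp: approach_def)
  \<comment> \<open>The other two planes are avoided, so a limit solution that is not positive can
    only have \<open>x = 0\<close>.\<close>
  have "y \<noteq> 0" using p3p_y0(3)[OF t _ L(1,3)] L(4) vw(1) by blast
  moreover have "z \<noteq> 0" using p3p_z0(3)[OF t _ L(1,2)] L(4) vw(2) by blast
  ultimately have "x = 0" using H L by (metis order_le_less)
  then have "eventually (\<lambda>n. X n < m) sequentially" using order_tendstoD(2)[OF lim] m by simp
  then obtain n where n: "X n < m" by (auto simp: eventually_sequentially)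
  have nn: "T n > 0" "X n \<ge> 0" "Y n \<ge> 0" "Z n \<ge> 0" and sol: "p3p a b c (c1 + T n * d) v w (X n) (Y n) (Z n)"
    using ap by (auto simp: approach_def)
  have "X n \<noteq> 0"
  proof
    assume X0: "X n = 0"
    then have "c1 + T n * d = c1" using p3p_x0(3)[OF t sol[unfolded X0] nn(3,4)] by simp
    then show False using d nn by simp
  qed
  then have Xn: "0 < X n" "X n < b" "X n < c" using nn n by (auto simp: m_def)
  have "Y n = Y0 (X n)" "Z n = Z0 (X n)"
    unfolding Y0_def Z0_def using sol nn
    by (auto simp: p3p_def intro!: plus_root(3)[OF Xn(1,3) bd2(2)] plus_root(3)[OF Xn(1,2) bd2(1)])
  then have "h (X n) = 2 * Y n * Z n * T n * d" using sol by (simp add: h_def p3p_def algebra_simps)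
  then have "h (X n) * d = 2 * Y n * Z n * T n * (d * d)" by simp
  also have "\<dots> \<ge> 0" using nn by simp
  finally show False using d(2)[of "X n"] n nn \<open>X n \<noteq> 0\<close> by auto
qed

text \<open>With a right angle at \<open>B\<close> the slope of \<open>slope_exclude\<close> vanishes on \<open>v = 0\<close>.\<close>

lemma right_angle_exclude:
  assumes t: "tri a b c c1 0 c3" and ap: "approach a b c c1 0 w 1 (-1) 0 T X Y Z 0 y z"
    and g: "gram c1 0 w > 0"
  shows False
proof -
  note pos = triD(1-3)[OF t]
  have law: "b\<^sup>2 = a\<^sup>2 + c\<^sup>2" using triD(8)[OF t] by linarith
  have cb: "c = b*c1" using tri_projection(3)[OF t] by linarith
  have c1: "c1 > 0" "c1\<^sup>2 < 1" using tri_nonacute[OF t] triD(4)[OF t] by simp_all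
  have sol: "p3p a b c (c1 + T n) (- T n) w (X n) (Y n) (Z n)"
    and nn: "T n > 0" "X n \<ge> 0" "Y n \<ge> 0" "Z n \<ge> 0" for n using ap by (auto simp: approach_def)
  have lim: "T \<longlonglongrightarrow> 0" "X \<longlonglongrightarrow> 0" "Y \<longlonglongrightarrow> y" "Z \<longlonglongrightarrow> z"
    and L: "p3p a b c c1 0 w 0 y z" "y \<ge> 0" "z \<ge> 0"
    using ap unfolding approach_def by blast+
  note yz = p3p_x0(1,2)[OF t L]
  \<comment> \<open>\<open>S\<close> is \<open>(Y - c1*Z) / X\<close> in a form that has a limit,
    namely \<open>w\<close>. Along the direction \<open>(1, -1, 0)\<close> the first two laws give
    \<open>(Y - c1*Z)^2 >= (1 - c1^2) * X^2\<close>. Hence \<open>w^2 >= 1 - c1^2\<close>, against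
    the positive Gram determinant.\<close>
  define S where "S = (\<lambda>n. (2 * Y n * w - X n) / (Y n + c) - c1 * ((2 * Z n * (- T n) - X n) / (Z n + b)))"
  have Sn: "(S n)\<^sup>2 \<ge> 1 - c1\<^sup>2" for n
  proof -
    have p: "Y n + c > 0" "Z n + b > 0" using nn[of n] pos by auto
    have e: "(Y n)\<^sup>2 + (Z n)\<^sup>2 - 2*Y n*Z n*(c1 + T n) = a\<^sup>2"
      "(X n)\<^sup>2 + (Z n)\<^sup>2 - 2*X n*Z n*(- T n) = b\<^sup>2"
      "(X n)\<^sup>2 + (Y n)\<^sup>2 - 2*X n*Y n*w = c\<^sup>2" using sol by (auto simp: p3p_def)
    have Ye: "X n * (2 * Y n * w - X n) = (Y n - c) * (Y n + c)"
      and Ze: "X n * (2 * Z n * (- T n) - X n) = (Z n - b) * (Z n + b)"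
      using e by (simp_all add: power2_eq_square algebra_simps)
    have "X n * S n = (X n * (2 * Y n * w - X n)) / (Y n + c) - c1 * ((X n * (2 * Z n * (- T n) - X n)) / (Z n + b))"
      by (simp add: S_def right_diff_distrib)
    also have "\<dots> = Y n - c1 * Z n" unfolding Ye Ze using p cb by (simp add: right_diff_distrib)
    finally have XS: "X n * S n = Y n - c1 * Z n" .
    have "(Y n - c1 * Z n)\<^sup>2 = a\<^sup>2 - (1 - c1\<^sup>2) * (Z n)\<^sup>2 + 2 * Y n * Z n * T n"
      using e(1) by (simp add: power2_eq_square algebra_simps)
    moreover have "a\<^sup>2 = (1 - c1\<^sup>2) * b\<^sup>2" using law cb by (simp add: power_mult_distrib algebra_simps)
    moreover have "2 * Y n * Z n * T n \<ge> 0" using nn[of n] by simp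
    ultimately have "(Y n - c1 * Z n)\<^sup>2 \<ge> (1 - c1\<^sup>2) * (b\<^sup>2 - (Z n)\<^sup>2)" by (simp add: right_diff_distrib)
    moreover have "(1 - c1\<^sup>2) * (X n)\<^sup>2 \<le> (1 - c1\<^sup>2) * (b\<^sup>2 - (Z n)\<^sup>2)"
    proof -
      have "0 \<le> 2*X n*Z n*T n" using nn[of n] by simp
      moreover have "2*X n*Z n*(- T n) = - (2*X n*Z n*T n)" by simp
      ultimately have "(X n)\<^sup>2 \<le> b\<^sup>2 - (Z n)\<^sup>2" using e(2) by linarith
      then show ?thesis using c1 by (intro mult_left_mono) auto
    qed
    ultimately have ge: "(1 - c1\<^sup>2) * (X n)\<^sup>2 \<le> (S n)\<^sup>2 * (X n)\<^sup>2"
      by (simp add: XS[symmetric] power_mult_distrib mult.commute)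
    have "X n \<noteq> 0"
    proof
      assume X0: "X n = 0"
      then have "c1 + T n = c1" using p3p_x0(3)[OF t sol[of n, unfolded X0] nn(3,4)] by simp
      then show False using nn(1)[of n] by simp
    qed
    then show ?thesis using ge by simp
  qed
  have "S \<longlonglongrightarrow> (2 * y * w - 0) / (y + c) - c1 * ((2 * z * (- 0) - 0) / (z + b))"
    unfolding S_def using pos yz by (intro tendsto_intros lim) auto
  then have "S \<longlonglongrightarrow> w" using yz pos by simp
  then have "(\<lambda>n. (S n)\<^sup>2) \<longlonglongrightarrow> w\<^sup>2" by (intro tendsto_intros)
  then have "1 - c1\<^sup>2 \<le> w\<^sup>2" using Sn by (intro LIMSEQ_le_const) auto
  then show False using g by (simp add: gram_def)
qed

text \<open>One direction has to exclude all three zeros. The slopes at \<open>x = 0\<close> and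
  \<open>y = 0\<close> have the signs of \<open>c2\<close> and \<open>c1\<close>, because
  \<open>w + c3 > 0\<close>; this dictates \<open>d1\<close> and the entry \<open>-1\<close>, with
  \<open>c2 = 0\<close> left to \<open>right_angle_exclude\<close>. A zero of \<open>z\<close> needs
  \<open>w = c3\<close>: for \<open>c2 > 0\<close> the choice \<open>d3 = -1\<close> excludes it,
  otherwise the Gram determinant \<open>4*c1*c2*c3\<close> would not be positive.\<close>

lemma p3p_near_two_planes_acute:
  assumes t: "tri a b c c1 c2 c3" and near: "p3p_near a b c c1 c2 w"
    and g: "gram c1 c2 w > 0" and c1: "c1 > 0"
  shows "\<exists>x>0. \<exists>y>0. \<exists>z>0. p3p a b c c1 c2 w x y z"
proof -
  have wc: "w + c3 > 0" using tri_gram_third[OF t g] .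
  have bd: "\<bar>c1\<bar> < 1" "\<bar>c2\<bar> < 1" using triD(4,5)[OF t] by (simp_all add: abs_square_less_1)
  define d1 where "d1 = (if c2 > 0 then -1 else 1 :: real)"
  define d3 where "d3 = (if c2 > 0 then -1 else 0 :: real)"
  obtain T X Y Z x y z where ap: "approach a b c c1 c2 w d1 (-1) d3 T X Y Z x y z"
    using approach_exists[OF near bd] .
  then have L: "x \<ge> 0" "y \<ge> 0" "z \<ge> 0" "p3p a b c c1 c2 w x y z"
    by (auto simp: approach_def)
  have "x \<noteq> 0"
  proof
    assume x: "x = 0"
    consider "c2 > 0" | "c2 = 0" | "c2 < 0" by linarith
    then show False
    proof cases
      case 1
      then have "(w + c3) * c2 > 0" using wc by simp
      then show False using slope_exclude[OF t ap[unfolded x]] 1 by (simp add: d1_def algebra_simps)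
    next
      case 2
      then show False using right_angle_exclude t ap g x by (auto simp: d1_def d3_def)
    next
      case 3
      then have "(w + c3) * c2 < 0" using wc by (simp add: mult_pos_neg)
      then show False using slope_exclude[OF t ap[unfolded x]] 3 by (simp add: d1_def algebra_simps)
    qed
  qed
  moreover have "y \<noteq> 0"
  proof
    assume y: "y = 0"
    have "(w + c3) * c1 > 0" using wc c1 by simp
    then show False using slope_exclude[OF tri_swap12[OF t] approach_swap12[OF ap[unfolded y]]]
      by (simp add: algebra_simps)
  qed
  moreover have "z \<noteq> 0"
  proof
    assume z: "z = 0"
    then have w: "w = c3" using p3p_z0(3)[OF t _ L(1,2)] L(4) by blast
    show False
    proof (cases "c2 > 0")
      case True
      then have "c1 * c2 > 0" using c1 by simp
      then show False
        using slope_exclude[OF tri_swap12[OF tri_swap23[OF t]] approach_swap12[OF approach_swap23[OF ap[unfolded z w]]]] True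
        by (simp add: d3_def algebra_simps)
    next
      case False
      then have "c3 > 0" using tri_nonacute[OF t] by simp
      then have "4 * c1 * c3 * c2 \<le> 0" using c1 False by (intro mult_nonneg_nonpos) auto
      then show False using g tri_gram[OF t] w by (simp add: mult_ac)
    qed
  qed
  ultimately show ?thesis using L by (metis order_le_less)
qed

lemma p3p_near_two_planes:
  assumes t: "tri a b c c1 c2 c3" and near: "p3p_near a b c c1 c2 w"
    and g: "gram c1 c2 w > 0"
  shows "\<exists>x>0. \<exists>y>0. \<exists>z>0. p3p a b c c1 c2 w x y z"
proof (cases "c1 > 0")
  case True
  then show ?thesis using p3p_near_two_planes_acute assms by blast
next
  case False
  then have "c2 > 0" using tri_nonacute[OF tri_swap12[OF t]] by simp
  moreover have "gram c2 c1 w > 0" using g by (simp add: gram_def algebra_simps)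
  ultimately obtain x y z where "x > 0" "y > 0" "z > 0" "p3p b a c c2 c1 w x y z"
    using p3p_near_two_planes_acute[OF tri_swap12[OF t] p3p_near_swap12[OF near]] by metis
  moreover from this have "p3p a b c c1 c2 w y x z" by (subst p3p_swap12)
  ultimately show ?thesis by auto
qed

lemma p3p_near_first_plane:
  assumes t: "tri a b c c1 c2 c3" and near: "p3p_near a b c c1 v w"
    and g: "gram c1 v w > 0" and bd: "\<bar>v\<bar> < 1" "\<bar>w\<bar> < 1"
  shows "\<exists>x>0. \<exists>y>0. \<exists>z>0. p3p a b c c1 v w x y z"
proof -
  consider "v = c2" | "w = c3" | "v \<noteq> c2" "w \<noteq> c3" by blast
  then show ?thesis
  proof cases
    case 1
    then show ?thesis using p3p_near_two_planes[OF t] near g by simp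
  next
    case 2
    have "gram c1 w v > 0" using g by (simp add: gram_def algebra_simps)
    then obtain x y z where "x > 0" "y > 0" "z > 0" "p3p a c b c1 w v x y z"
      using p3p_near_two_planes[OF tri_swap23[OF t]] p3p_near_swap23[OF near] 2 by metis
    moreover from this have "p3p a b c c1 v w x z y" by (subst p3p_swap23)
    ultimately show ?thesis by auto
  next
    case 3
    then show ?thesis using p3p_near_single_plane[OF t near] bd by blast
  qed
qed

text \<open>A nonnegative solution with a zero coordinate puts the point on one of the planes
  \<open>u = c1\<close>, \<open>v = c2\<close>, \<open>w = c3\<close>. Off these planes any
  nonnegative solution is positive; on them a permutation of the vertices reduces to the first
  plane.\<close>

lemma p3p_near_imp_positive:
  assumes t: "tri a b c c1 c2 c3" and near: "p3p_near a b c u v w"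
    and g: "gram u v w > 0" and bd: "\<bar>u\<bar> < 1" "\<bar>v\<bar> < 1" "\<bar>w\<bar> < 1"
  shows "\<exists>x>0. \<exists>y>0. \<exists>z>0. p3p a b c u v w x y z"
proof -
  consider "u = c1" | "v = c2" | "w = c3" | "u \<noteq> c1" "v \<noteq> c2" "w \<noteq> c3" by blast
  then show ?thesis
  proof cases
    case 1
    then show ?thesis using p3p_near_first_plane[OF t] near g bd by simp
  next
    case 2
    have "gram v u w > 0" using g by (simp add: gram_def algebra_simps)
    then obtain x y z where "x > 0" "y > 0" "z > 0" "p3p b a c v u w x y z"
      using p3p_near_first_plane[OF tri_swap12[OF t]] p3p_near_swap12[OF near] bd 2 by metis
    moreover from this have "p3p a b c u v w y x z" by (subst p3p_swap12)
    ultimately show ?thesis by auto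
  next
    case 3
    have "gram w u v > 0" using g by (simp add: gram_def algebra_simps)
    then obtain x y z where "x > 0" "y > 0" "z > 0" "p3p c a b w u v x y z"
      using p3p_near_first_plane[OF tri_swap12[OF tri_swap23[OF t]]] p3p_near_swap12[OF p3p_near_swap23[OF near]] bd 3 by metis
    moreover from this have "p3p a b c u v w y z x" by (subst p3p_swap23, subst p3p_swap12)
    ultimately show ?thesis by auto
  next
    case 4
    obtain x y z where L: "x \<ge> 0" "y \<ge> 0" "z \<ge> 0" "p3p a b c u v w x y z"
      using near unfolding p3p_near_def by (metis abs_zero diff_self)
    have "x \<noteq> 0" "y \<noteq> 0" "z \<noteq> 0"
      using p3p_x0(3)[OF t _ L(2,3)] p3p_y0(3)[OF t _ L(1,3)] p3p_z0(3)[OF t _ L(1,2)] L(4) 4 by blast+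
    then show ?thesis using L by (metis order_le_less)
  qed
qed

subsection \<open>From distances to points\<close>

lemma Pi_zero_iff: "D \<in> Pi_zero \<longleftrightarrow> D$3 = 0"
proof
  assume "D$3 = 0"
  then have "D = vector [D$1, D$2, 0]" by (simp add: vec_eq_iff forall_3)
  then show "D \<in> Pi_zero" unfolding Pi_zero_def by blast
qed (auto simp: Pi_zero_def)

lemma Pi_plus_iff: "D \<in> Pi_plus \<longleftrightarrow> D$3 > 0"
proof
  assume "D$3 > 0"
  moreover have "D = vector [D$1, D$2, D$3]" by (simp add: vec_eq_iff forall_3)
  ultimately show "D \<in> Pi_plus" unfolding Pi_plus_def by blast
qed (auto simp: Pi_plus_def)

lemma norm3_sq: "(norm x)\<^sup>2 = (x$1)\<^sup>2 + (x$2)\<^sup>2 + (x$3)\<^sup>2" for x :: "real^3"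
  unfolding power2_norm_eq_inner by (simp add: inner_vec_def sum_3 power2_eq_square)

lemma cos_angle: "cos (angle K M L) = ((K - M) \<bullet> (L - M)) / (norm (K - M) * norm (L - M))"
proof -
  let ?r = "((K - M) \<bullet> (L - M)) / (norm (K - M) * norm (L - M))"
  have "\<bar>?r\<bar> \<le> 1"
    using Cauchy_Schwarz_ineq2[of "K - M" "L - M"] by (auto simp: abs_mult divide_le_eq_1 abs_divide)
  then have "-1 \<le> ?r" "?r \<le> 1" by linarith+
  then show ?thesis unfolding angle_def by (rule cos_arccos)
qed

lemma inner_polar: "(norm (x - y))\<^sup>2 = (norm x)\<^sup>2 + (norm y)\<^sup>2 - 2 * (x \<bullet> y)" for x y :: "real^3"
  unfolding power2_norm_eq_inner by (simp add: inner_diff_left inner_diff_right inner_commute)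

lemma cosine_rule:
  assumes "M \<noteq> K" "M \<noteq> L"
  shows "(dist K M)\<^sup>2 + (dist L M)\<^sup>2 - 2 * dist K M * dist L M * cos (angle K M L) = (dist K L)\<^sup>2"
proof -
  have "dist K M * dist L M * cos (angle K M L) = (K - M) \<bullet> (L - M)"
    unfolding cos_angle dist_norm using assms by simp
  moreover have "(dist K L)\<^sup>2 = (dist K M)\<^sup>2 + (dist L M)\<^sup>2 - 2 * ((K - M) \<bullet> (L - M))"
    using inner_polar[of "K - M" "L - M"] by (simp add: dist_norm)
  ultimately show ?thesis by simp
qed

lemma cosine_rule_unique:
  assumes "dist K M > 0" "dist L M > 0"
    and "(dist K M)\<^sup>2 + (dist L M)\<^sup>2 - 2 * dist K M * dist L M * u = (dist K L)\<^sup>2"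
  shows "cos (angle K M L) = u"
proof -
  have "M \<noteq> K" "M \<noteq> L" using assms(1,2) by auto
  from cosine_rule[OF this] assms(3)
  have "2 * dist K M * dist L M * u = 2 * dist K M * dist L M * cos (angle K M L)" by linarith
  then show ?thesis using assms(1,2) by auto
qed

lemma dist_sq: "(dist P Q)\<^sup>2 = (P$1 - Q$1)\<^sup>2 + (P$2 - Q$2)\<^sup>2 + (P$3 - Q$3)\<^sup>2" for P Q :: "real^3"
  by (simp add: dist_norm norm3_sq)

lemma noncollinear_cos:
  assumes "\<not> collinear {K, M, L}"
  shows "(cos (angle K M L))\<^sup>2 < 1"
proof -
  have "\<bar>(K - M) \<bullet> (L - M)\<bar> \<noteq> norm (K - M) * norm (L - M)"
    using assms unfolding norm_cauchy_schwarz_equal using collinear_3[of K M L] by simp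
  then have lt: "\<bar>(K - M) \<bullet> (L - M)\<bar> < norm (K - M) * norm (L - M)"
    using Cauchy_Schwarz_ineq2[of "K - M" "L - M"] by linarith
  then have "norm (K - M) * norm (L - M) > 0" by linarith
  then have "\<bar>cos (angle K M L)\<bar> < 1" unfolding cos_angle using lt by (simp add: abs_divide)
  then show ?thesis by (simp add: abs_square_less_1)
qed

text \<open>For an apex at horizontal offset \<open>(s, t)\<close> and distance \<open>x\<close>
  from the base vertex 0, both sides are the square of six times the volume of the tetrahedron. The
  algebraic form does not presuppose that \<open>x^2 - s^2 - t^2\<close> is a squared height, so it
  can also produce the apex.\<close>

lemma tetra_gram:
  fixes p1 p2 r1 r2 x y z u v w m n s t :: real
  assumes P: "p1\<^sup>2 + p2\<^sup>2 = x\<^sup>2 + y\<^sup>2 - 2*x*y*w" and R: "r1\<^sup>2 + r2\<^sup>2 = x\<^sup>2 + z\<^sup>2 - 2*x*z * v"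
    and Q: "(p1-r1)\<^sup>2 + (p2-r2)\<^sup>2 = y\<^sup>2 + z\<^sup>2 - 2*y*z*u"
    and m: "s*p1 + t*p2 = x\<^sup>2 - x*y*w" and n: "s*r1 + t*r2 = x\<^sup>2 - x*z * v"
  shows "(p1*r2 - p2*r1)\<^sup>2 * (x\<^sup>2 - s\<^sup>2 - t\<^sup>2) = (x*y*z)\<^sup>2 * gram u v w"
proof -
  have k: "p1*r1 + p2*r2 = x\<^sup>2 - x*y*w - x*z * v + y*z*u"
    using P R Q by (simp add: power2_eq_square algebra_simps)
  \<comment> \<open>The norm of \<open>(s, t)\<close> is expressed by its inner products with the
    base edges, through their Gram determinant.\<close>
  have "(p1*r2 - p2*r1)\<^sup>2 * (s\<^sup>2 + t\<^sup>2) =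
     (s*p1 + t*p2)\<^sup>2 * (r1\<^sup>2 + r2\<^sup>2) - 2*(s*p1 + t*p2)*(s*r1 + t*r2)*(p1*r1 + p2*r2) + (s*r1 + t*r2)\<^sup>2 * (p1\<^sup>2 + p2\<^sup>2)"
    by (simp add: power2_eq_square algebra_simps)
  moreover have "(p1*r2 - p2*r1)\<^sup>2 = (p1\<^sup>2 + p2\<^sup>2)*(r1\<^sup>2 + r2\<^sup>2) - (p1*r1 + p2*r2)\<^sup>2"
    by (simp add: power2_eq_square algebra_simps)
  moreover have "(p1*r2 - p2*r1)\<^sup>2 * (x\<^sup>2 - s\<^sup>2 - t\<^sup>2) = (p1*r2 - p2*r1)\<^sup>2 * x\<^sup>2 - (p1*r2 - p2*r1)\<^sup>2 * (s\<^sup>2 + t\<^sup>2)"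
    by (simp add: algebra_simps)
  ultimately have "(p1*r2 - p2*r1)\<^sup>2 * (x\<^sup>2 - s\<^sup>2 - t\<^sup>2) =
      ((p1\<^sup>2 + p2\<^sup>2)*(r1\<^sup>2 + r2\<^sup>2) - (p1*r1 + p2*r2)\<^sup>2) * x\<^sup>2 -
      ((s*p1 + t*p2)\<^sup>2 * (r1\<^sup>2 + r2\<^sup>2) - 2*(s*p1 + t*p2)*(s*r1 + t*r2)*(p1*r1 + p2*r2) + (s*r1 + t*r2)\<^sup>2 * (p1\<^sup>2 + p2\<^sup>2))"
    by simp
  also have "\<dots> = (x*y*z)\<^sup>2 * gram u v w"
    unfolding P R k m n gram_def by (simp add: power2_eq_square algebra_simps)
  finally show ?thesis .
qed

section \<open>The base triangle and its apex\<close>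

locale base_triangle =
  fixes A B C :: "real^3"
  assumes flat: "A$3 = 0" "B$3 = 0" "C$3 = 0" and nc: "\<not> collinear {A, B, C}"
begin

text \<open>Twice the signed area of the base triangle.\<close>

definition \<Delta> :: real where "\<Delta> = (B$1 - A$1)*(C$2 - A$2) - (B$2 - A$2)*(C$1 - A$1)"

lemma distinct: "A \<noteq> B" "A \<noteq> C" "B \<noteq> C"
  using nc by (auto simp: insert_commute)

lemma tri_ABC: "tri (dist B C) (dist A C) (dist A B) (cos (angle B A C)) (cos (angle A B C)) (cos (angle A C B))"
proof -
  have "\<not> collinear {B, A, C}" "\<not> collinear {A, B, C}" "\<not> collinear {A, C, B}"
    using nc by (simp_all add: insert_commute)
  then show ?thesis
    unfolding tri_def using distinct cosine_rule[of A B C] cosine_rule[of B A C] cosine_rule[of C A B]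
    by (auto intro!: noncollinear_cos simp: dist_commute algebra_simps)
qed

lemma \<Delta>_nz: "\<Delta> \<noteq> 0"
proof
  assume "\<Delta> = 0"
  have nc': "\<not> collinear {B, A, C}" using nc by (simp add: insert_commute)
  \<comment> \<open>Lagrange's identity: zero area means equality in Cauchy-Schwarz, that is,
    collinearity.\<close>
  have "(norm (B - A) * norm (C - A))\<^sup>2 = ((B - A) \<bullet> (C - A))\<^sup>2 + \<Delta>\<^sup>2"
    unfolding power_mult_distrib norm3_sq \<Delta>_def
    by (simp add: flat inner_vec_def sum_3 power2_eq_square algebra_simps)
  then have "\<bar>(B - A) \<bullet> (C - A)\<bar>\<^sup>2 = (norm (B - A) * norm (C - A))\<^sup>2" using \<open>\<Delta> = 0\<close> by simp
  then have "\<bar>(B - A) \<bullet> (C - A)\<bar> = norm (B - A) * norm (C - A)"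
    by (rule power2_eq_imp_eq) auto
  then have "collinear {0, B - A, C - A}" by (simp add: norm_cauchy_schwarz_equal)
  then show False using nc' collinear_3[of B A C] by simp
qed

lemma p3p_dist:
  assumes "D \<noteq> A" "D \<noteq> B" "D \<noteq> C"
  shows "p3p (dist B C) (dist A C) (dist A B) (cos (angle B D C)) (cos (angle A D C)) (cos (angle A D B))
    (dist A D) (dist B D) (dist C D)"
  unfolding p3p_def using assms by (simp add: cosine_rule)

lemma Pi_plus_ne: "D \<in> Pi_plus \<Longrightarrow> D \<noteq> A \<and> D \<noteq> B \<and> D \<noteq> C"
  using flat by (auto simp: Pi_plus_iff)

lemma gram_dist:
  assumes "p3p (dist B C) (dist A C) (dist A B) u v w (dist A D) (dist B D) (dist C D)"
  shows "\<Delta>\<^sup>2 * (D$3)\<^sup>2 = (dist A D * dist B D * dist C D)\<^sup>2 * gram u v w"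
proof -
  note s = dist_sq[of A B] dist_sq[of A C] dist_sq[of B C] dist_sq[of A D] dist_sq[of B D] dist_sq[of C D]
  have "\<Delta>\<^sup>2 * ((dist A D)\<^sup>2 - (D$1-A$1)\<^sup>2 - (D$2-A$2)\<^sup>2) = (dist A D * dist B D * dist C D)\<^sup>2 * gram u v w"
    unfolding \<Delta>_def
  proof (rule tetra_gram)
    have e: "(dist B D)\<^sup>2 + (dist C D)\<^sup>2 - 2*dist B D*dist C D*u = (dist B C)\<^sup>2"
      "(dist A D)\<^sup>2 + (dist C D)\<^sup>2 - 2*dist A D*dist C D * v = (dist A C)\<^sup>2"
      "(dist A D)\<^sup>2 + (dist B D)\<^sup>2 - 2*dist A D*dist B D*w = (dist A B)\<^sup>2"
      using assms by (auto simp: p3p_def)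
    show "(B$1 - A$1)\<^sup>2 + (B$2 - A$2)\<^sup>2 = (dist A D)\<^sup>2 + (dist B D)\<^sup>2 - 2*dist A D*dist B D*w"
      unfolding e unfolding dist_sq flat by (simp add: power2_commute)
    show "(C$1 - A$1)\<^sup>2 + (C$2 - A$2)\<^sup>2 = (dist A D)\<^sup>2 + (dist C D)\<^sup>2 - 2*dist A D*dist C D * v"
      unfolding e unfolding dist_sq flat by (simp add: power2_commute)
    show "(B$1 - A$1 - (C$1 - A$1))\<^sup>2 + (B$2 - A$2 - (C$2 - A$2))\<^sup>2 = (dist B D)\<^sup>2 + (dist C D)\<^sup>2 - 2*dist B D*dist C D*u"
      unfolding e unfolding dist_sq flat by (simp add: power2_commute)
    have "2 * (dist A D * dist B D * w) = (dist A D)\<^sup>2 + (dist B D)\<^sup>2 - (dist A B)\<^sup>2" using e(3) by simp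
    then have "2 * ((dist A D)\<^sup>2 - dist A D * dist B D * w) = (dist A D)\<^sup>2 - (dist B D)\<^sup>2 + (dist A B)\<^sup>2" by simp
    also have "\<dots> = 2 * ((D$1 - A$1)*(B$1 - A$1) + (D$2 - A$2)*(B$2 - A$2))"
      unfolding dist_sq flat by (simp add: power2_eq_square algebra_simps)
    finally show "(D$1 - A$1)*(B$1 - A$1) + (D$2 - A$2)*(B$2 - A$2) = (dist A D)\<^sup>2 - dist A D * dist B D * w" by simp
    have "2 * (dist A D * dist C D * v) = (dist A D)\<^sup>2 + (dist C D)\<^sup>2 - (dist A C)\<^sup>2" using e(2) by simp
    then have "2 * ((dist A D)\<^sup>2 - dist A D * dist C D * v) = (dist A D)\<^sup>2 - (dist C D)\<^sup>2 + (dist A C)\<^sup>2" by simp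
    also have "\<dots> = 2 * ((D$1 - A$1)*(C$1 - A$1) + (D$2 - A$2)*(C$2 - A$2))"
      unfolding dist_sq flat by (simp add: power2_eq_square algebra_simps)
    finally show "(D$1 - A$1)*(C$1 - A$1) + (D$2 - A$2)*(C$2 - A$2) = (dist A D)\<^sup>2 - dist A D * dist C D * v" by simp
  qed
  moreover have "(dist A D)\<^sup>2 - (D$1-A$1)\<^sup>2 - (D$2-A$2)\<^sup>2 = (D$3)\<^sup>2"
    unfolding dist_sq flat by (simp add: power2_commute)
  ultimately show ?thesis by simp
qed

lemma gram_pos:
  assumes "D \<in> Pi_plus"
  shows "gram (cos (angle B D C)) (cos (angle A D C)) (cos (angle A D B)) > 0"
proof -
  have "\<Delta>\<^sup>2 * (D$3)\<^sup>2 > 0" using \<Delta>_nz assms by (simp add: Pi_plus_iff)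
  then have "(dist A D * dist B D * dist C D)\<^sup>2 * gram (cos (angle B D C)) (cos (angle A D C)) (cos (angle A D B)) > 0"
    using gram_dist[OF p3p_dist] Pi_plus_ne[OF assms] by simp
  then show ?thesis by (simp add: zero_less_mult_iff)
qed

lemma apex_exists:
  assumes p: "p3p (dist B C) (dist A C) (dist A B) u v w x y z" and g: "gram u v w > 0"
    and pos: "x > 0" "y > 0" "z > 0"
  obtains D where "D \<in> Pi_plus" "cos_triple A B C D = vector [u, v, w]"
proof -
  \<comment> \<open>The cosine laws force the inner products \<open>m\<close> and \<open>n\<close>
    of the edge from \<open>A\<close> to the apex with the edges \<open>AB\<close> and
    \<open>AC\<close>. Cramer's rule turns them into the horizontal offset \<open>(s, t)\<close>,
    and the positive Gram determinant leaves room for a positive height.\<close>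
  define m where "m = x\<^sup>2 - x*y*w"
  define n where "n = x\<^sup>2 - x*z * v"
  define s where "s = (m*(C$2-A$2) - n*(B$2-A$2)) / \<Delta>"
  define t where "t = (n*(B$1-A$1) - m*(C$1-A$1)) / \<Delta>"
  have e: "y\<^sup>2 + z\<^sup>2 - 2*y*z*u = (dist B C)\<^sup>2" "x\<^sup>2 + z\<^sup>2 - 2*x*z * v = (dist A C)\<^sup>2" "x\<^sup>2 + y\<^sup>2 - 2*x*y*w = (dist A B)\<^sup>2"
    using p by (auto simp: p3p_def)
  have sm: "s*(B$1-A$1) + t*(B$2-A$2) = m" and sn: "s*(C$1-A$1) + t*(C$2-A$2) = n"
  proof -
    have "\<Delta> * (s*(B$1-A$1) + t*(B$2-A$2)) = \<Delta> * m" "\<Delta> * (s*(C$1-A$1) + t*(C$2-A$2)) = \<Delta> * n"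
      using \<Delta>_nz unfolding s_def t_def by (simp_all add: distrib_left) (simp_all add: \<Delta>_def algebra_simps)
    then show "s*(B$1-A$1) + t*(B$2-A$2) = m" "s*(C$1-A$1) + t*(C$2-A$2) = n" using \<Delta>_nz by simp_all
  qed
  have "\<Delta>\<^sup>2 * (x\<^sup>2 - s\<^sup>2 - t\<^sup>2) = (x*y*z)\<^sup>2 * gram u v w"
    unfolding \<Delta>_def
  proof (rule tetra_gram)
    show "(B$1 - A$1)\<^sup>2 + (B$2 - A$2)\<^sup>2 = x\<^sup>2 + y\<^sup>2 - 2*x*y*w"
      unfolding e unfolding dist_sq flat by (simp add: power2_commute)
    show "(C$1 - A$1)\<^sup>2 + (C$2 - A$2)\<^sup>2 = x\<^sup>2 + z\<^sup>2 - 2*x*z * v"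
      unfolding e unfolding dist_sq flat by (simp add: power2_commute)
    show "(B$1 - A$1 - (C$1 - A$1))\<^sup>2 + (B$2 - A$2 - (C$2 - A$2))\<^sup>2 = y\<^sup>2 + z\<^sup>2 - 2*y*z*u"
      unfolding e unfolding dist_sq flat by (simp add: power2_commute)
  qed (use sm sn in \<open>auto simp: m_def n_def\<close>)
  also have "\<dots> > 0" using g pos by simp
  finally have h: "x\<^sup>2 - s\<^sup>2 - t\<^sup>2 > 0" by (simp add: zero_less_mult_iff)
  define D :: "real^3" where "D = vector [A$1 + s, A$2 + t, sqrt (x\<^sup>2 - s\<^sup>2 - t\<^sup>2)]"
  have D3: "(D$3)\<^sup>2 = x\<^sup>2 - s\<^sup>2 - t\<^sup>2" using h by (simp add: D_def)
  have DA: "(dist A D)\<^sup>2 = x\<^sup>2"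
    unfolding dist_sq flat using D3 by (simp add: D_def)
  have DB: "(dist B D)\<^sup>2 = y\<^sup>2"
  proof -
    have "(dist B D)\<^sup>2 = (dist A D)\<^sup>2 + (dist A B)\<^sup>2 - 2*(s*(B$1-A$1) + t*(B$2-A$2))"
      unfolding dist_sq flat by (simp add: D_def power2_eq_square algebra_simps)
    then show ?thesis unfolding sm DA e[symmetric] m_def by simp
  qed
  have DC: "(dist C D)\<^sup>2 = z\<^sup>2"
  proof -
    have "(dist C D)\<^sup>2 = (dist A D)\<^sup>2 + (dist A C)\<^sup>2 - 2*(s*(C$1-A$1) + t*(C$2-A$2))"
      unfolding dist_sq flat by (simp add: D_def power2_eq_square algebra_simps)
    then show ?thesis unfolding sn DA e[symmetric] n_def by simp
  qed
  have d: "dist A D = x" "dist B D = y" "dist C D = z"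
    using DA DB DC pos by (auto intro: power2_eq_imp_eq)
  have "cos (angle B D C) = u" "cos (angle A D C) = v" "cos (angle A D B) = w"
    by (rule cosine_rule_unique; (simp add: d pos e))+
  then have "cos_triple A B C D = vector [u, v, w]" by (simp add: cos_triple_def)
  moreover have "D \<in> Pi_plus" using h by (simp add: Pi_plus_iff D_def)
  ultimately show ?thesis using that by blast
qed

lemma image_Pi_plus_iff:
  "q \<in> cos_triple A B C ` Pi_plus \<longleftrightarrow>
    gram (q$1) (q$2) (q$3) > 0 \<and> (\<exists>x>0. \<exists>y>0. \<exists>z>0. p3p (dist B C) (dist A C) (dist A B) (q$1) (q$2) (q$3) x y z)"
proof
  assume "q \<in> cos_triple A B C ` Pi_plus"
  then obtain D where D: "D \<in> Pi_plus" "q = cos_triple A B C D" by blast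
  have pos: "dist A D > 0" "dist B D > 0" "dist C D > 0" using Pi_plus_ne[OF D(1)] by auto
  have q: "q$1 = cos (angle B D C)" "q$2 = cos (angle A D C)" "q$3 = cos (angle A D B)"
    by (simp_all add: D(2) cos_triple_def)
  have "p3p (dist B C) (dist A C) (dist A B) (q$1) (q$2) (q$3) (dist A D) (dist B D) (dist C D)"
    unfolding q using p3p_dist Pi_plus_ne[OF D(1)] by blast
  then show "gram (q$1) (q$2) (q$3) > 0 \<and> (\<exists>x>0. \<exists>y>0. \<exists>z>0. p3p (dist B C) (dist A C) (dist A B) (q$1) (q$2) (q$3) x y z)"
    using gram_pos[OF D(1)] pos unfolding q by blast
next
  assume r: "gram (q$1) (q$2) (q$3) > 0 \<and> (\<exists>x>0. \<exists>y>0. \<exists>z>0. p3p (dist B C) (dist A C) (dist A B) (q$1) (q$2) (q$3) x y z)"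
  then obtain x y z where "x > 0" "y > 0" "z > 0" "p3p (dist B C) (dist A C) (dist A B) (q$1) (q$2) (q$3) x y z" by blast
  then obtain D where "D \<in> Pi_plus" "cos_triple A B C D = vector [q$1, q$2, q$3]"
    using apex_exists r by blast
  moreover have "q = vector [q$1, q$2, q$3]" by (simp add: vec_eq_iff forall_3)
  ultimately show "q \<in> cos_triple A B C ` Pi_plus" by (metis imageI)
qed

end

subsection \<open>The interior of CFT\<close>

context base_triangle
begin

section \<open>The sets Sigma, SRT and GT in coordinates\<close>

lemma Pi_zero_affine_hull: "affine hull {A, B, C} = Pi_zero"
proof
  show "affine hull {A, B, C} \<subseteq> Pi_zero"
    unfolding affine_hull_3 by (auto simp: Pi_zero_iff flat)
  show "Pi_zero \<subseteq> affine hull {A, B, C}"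
  proof
    fix D assume "D \<in> Pi_zero"
    then have D3: "D$3 = 0" by (simp add: Pi_zero_iff)
    \<comment> \<open>Barycentric coordinates of \<open>D\<close> by Cramer's rule.\<close>
    define s where "s = ((D$1-A$1)*(C$2-A$2) - (D$2-A$2)*(C$1-A$1)) / \<Delta>"
    define t where "t = ((B$1-A$1)*(D$2-A$2) - (B$2-A$2)*(D$1-A$1)) / \<Delta>"
    have "\<Delta> * (s*(B$1-A$1) + t*(C$1-A$1)) = \<Delta> * (D$1-A$1)" "\<Delta> * (s*(B$2-A$2) + t*(C$2-A$2)) = \<Delta> * (D$2-A$2)"
      using \<Delta>_nz unfolding s_def t_def by (simp_all add: distrib_left) (simp_all add: \<Delta>_def algebra_simps)
    then have e: "s*(B$1-A$1) + t*(C$1-A$1) = D$1-A$1" "s*(B$2-A$2) + t*(C$2-A$2) = D$2-A$2"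
      using \<Delta>_nz by simp_all
    have "D = (1 - s - t) *\<^sub>R A + s *\<^sub>R B + t *\<^sub>R C"
      using e by (simp add: vec_eq_iff forall_3 D3 flat algebra_simps)
    then show "D \<in> affine hull {A, B, C}" unfolding affine_hull_3
      by (intro CollectI exI[of _ "1-s-t"] exI[of _ s] exI[of _ t]) auto
  qed
qed

lemma cos_triple_reflect:
  assumes "D'$1 = D$1" "D'$2 = D$2" "D'$3 = - D$3"
  shows "cos_triple A B C D' = cos_triple A B C D"
proof -
  have "dist P D' = dist P D" if "P$3 = 0" for P
    by (rule power2_eq_imp_eq) (auto simp: dist_sq assms that)
  then have n: "norm (P - D') = norm (P - D)" if "P$3 = 0" for P
    using that by (simp add: dist_norm)
  have i: "(P - D') \<bullet> (Q - D') = (P - D) \<bullet> (Q - D)" if "P$3 = 0" "Q$3 = 0" for P Q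
    by (simp add: inner_vec_def sum_3 assms that)
  show ?thesis unfolding cos_triple_def cos_angle by (simp add: n i flat)
qed

lemma Sigma_tri_eq: "Sigma_tri A B C = cos_triple A B C ` Pi_plus"
proof
  show "Sigma_tri A B C \<subseteq> cos_triple A B C ` Pi_plus"
  proof
    fix q assume "q \<in> Sigma_tri A B C"
    then obtain D where D: "D$3 \<noteq> 0" "q = cos_triple A B C D"
      unfolding Sigma_tri_def Pi_zero_affine_hull by (auto simp: Pi_zero_iff)
    define D' :: "real^3" where "D' = vector [D$1, D$2, - D$3]"
    have "cos_triple A B C D' = cos_triple A B C D" by (rule cos_triple_reflect) (simp_all add: D'_def)
    moreover have "D \<in> Pi_plus \<or> D' \<in> Pi_plus" using D(1) by (auto simp: Pi_plus_iff D'_def)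
    ultimately show "q \<in> cos_triple A B C ` Pi_plus" using D(2) by (metis imageI)
  qed
  show "cos_triple A B C ` Pi_plus \<subseteq> Sigma_tri A B C"
    unfolding Sigma_tri_def Pi_zero_affine_hull by (auto simp: Pi_zero_iff Pi_plus_iff)
qed

lemma SRT_subset: "SRT A B C \<subseteq> Pi_plus"
proof
  fix D assume "D \<in> SRT A B C"
  then obtain R where R: "R \<in> special_regions A B C"
    "D \<in> R \<or> D \<in> top_of_set (Cyl A B C \<inter> Pi_plus) frontier_of R"
    unfolding SRT_def by blast
  have "R \<subseteq> Pi_plus" using R(1) by (auto simp: special_regions_def region_below_def Pi_plus_iff)
  moreover have "top_of_set (Cyl A B C \<inter> Pi_plus) frontier_of R \<subseteq> Pi_plus"
    using frontier_of_subset_topspace[of "top_of_set (Cyl A B C \<inter> Pi_plus)" R] by auto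
  ultimately show "D \<in> Pi_plus" using R(2) by blast
qed

lemma GT_ne: "D \<in> GT A B C \<Longrightarrow> D \<noteq> A \<and> D \<noteq> B \<and> D \<noteq> C"
  using Pi_plus_ne by (auto simp: GT_def)

text \<open>At a point of the image the form is the squared norm of a combination of the unit
  vectors from \<open>D\<close> to the vertices; the inequality is closed and passes to the
  closure.\<close>

lemma CFT_psd:
  assumes "q \<in> CFT A B C"
  shows "r\<^sup>2 + s\<^sup>2 + t\<^sup>2 + 2 * s*t*q$1 + 2*r*t*q$2 + 2*r * s*q$3 \<ge> 0"
proof -
  let ?K = "{q :: real^3. 0 \<le> r\<^sup>2 + s\<^sup>2 + t\<^sup>2 + 2 * s*t*q$1 + 2*r*t*q$2 + 2*r * s*q$3}"
  have cl: "closed ?K" by (intro closed_Collect_le continuous_intros)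
  have "cos_triple A B C ` GT A B C \<subseteq> ?K"
  proof (rule image_subsetI)
    fix D assume "D \<in> GT A B C"
    then have ne: "D \<noteq> A" "D \<noteq> B" "D \<noteq> C" using GT_ne by blast+
    define e where "e = (\<lambda>P. (P - D) /\<^sub>R norm (P - D))"
    have ee: "e P \<bullet> e P = 1" if "D \<noteq> P" for P
      using that by (simp add: e_def power2_norm_eq_inner[symmetric] power2_eq_square)
    have ip: "e P \<bullet> e Q = cos (angle P D Q)" for P Q
      by (simp add: e_def cos_angle divide_simps)
    have "0 \<le> (r *\<^sub>R e A + s *\<^sub>R e B + t *\<^sub>R e C) \<bullet> (r *\<^sub>R e A + s *\<^sub>R e B + t *\<^sub>R e C)" by simp
    also have "\<dots> = r\<^sup>2 * (e A \<bullet> e A) + s\<^sup>2 * (e B \<bullet> e B) + t\<^sup>2 * (e C \<bullet> e C)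
        + 2 * s*t * (e B \<bullet> e C) + 2*r*t*(e A \<bullet> e C) + 2*r * s*(e A \<bullet> e B)"
      by (simp add: inner_add_left inner_add_right inner_commute power2_eq_square algebra_simps)
    finally show "cos_triple A B C D \<in> ?K" using ne by (simp add: ee cos_triple_def) (simp add: ip)
  qed
  then have "CFT A B C \<subseteq> ?K" unfolding CFT_def by (rule closure_minimal) (rule cl)
  then show ?thesis using assms by blast
qed

text \<open>The form is affine in \<open>q\<close> with value \<open>r^2 + s^2 + t^2 > 0\<close> at
  the origin. It is still nonnegative at \<open>(1 + d) *\<^sub>R q\<close>, slightly beyond
  \<open>q\<close>, hence positive at \<open>q\<close> in between.\<close>

lemma interior_CFT_pd:
  assumes "q \<in> interior (CFT A B C)" and nz: "r \<noteq> 0 \<or> s \<noteq> 0 \<or> t \<noteq> 0"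
  shows "r\<^sup>2 + s\<^sup>2 + t\<^sup>2 + 2 * s*t*q$1 + 2*r*t*q$2 + 2*r * s*q$3 > 0"
proof -
  obtain e where e: "e > 0" "ball q e \<subseteq> CFT A B C" using assms(1) by (meson mem_interior)
  define N where "N = norm q + 1"
  have N: "N > 0" by (simp add: N_def add_nonneg_pos)
  define d where "d = e / (2 * N)"
  have d: "d > 0" using e N by (simp add: d_def)
  have "norm (d *\<^sub>R q) = d * norm q" using d by simp
  also have "\<dots> \<le> d * N" using d by (simp add: N_def)
  also have "\<dots> = e / 2" using N by (simp add: d_def)
  also have "\<dots> < e" using e by simp
  finally have "(1 + d) *\<^sub>R q \<in> ball q e" by (simp add: dist_norm scaleR_add_left)
  then have "r\<^sup>2 + s\<^sup>2 + t\<^sup>2 + 2 * s*t*((1+d) * q$1) + 2*r*t*((1+d) * q$2) + 2*r * s*((1+d) * q$3) \<ge> 0"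
    using CFT_psd[of "(1 + d) *\<^sub>R q" r s t] e(2) by auto
  then have "(1+d) * (r\<^sup>2 + s\<^sup>2 + t\<^sup>2 + 2 * s*t*q$1 + 2*r*t*q$2 + 2*r * s*q$3) \<ge> d * (r\<^sup>2 + s\<^sup>2 + t\<^sup>2)"
    by (simp add: algebra_simps)
  moreover have "r\<^sup>2 + s\<^sup>2 + t\<^sup>2 > 0" using nz by (auto simp: add_pos_nonneg add_nonneg_pos)
  ultimately have "(1+d) * (r\<^sup>2 + s\<^sup>2 + t\<^sup>2 + 2 * s*t*q$1 + 2*r*t*q$2 + 2*r * s*q$3) > 0"
    using d by (smt (verit) mult_pos_pos)
  then show ?thesis using d by (simp add: zero_less_mult_iff)
qed

lemma interior_CFT_gram:
  assumes q: "q \<in> interior (CFT A B C)"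
  shows "\<bar>q$1\<bar> < 1" "\<bar>q$2\<bar> < 1" "\<bar>q$3\<bar> < 1" "gram (q$1) (q$2) (q$3) > 0"
proof -
  show u: "\<bar>q$1\<bar> < 1"
    using interior_CFT_pd[OF q, of 0 1 1] interior_CFT_pd[OF q, of 0 1 "-1"] by simp
  show "\<bar>q$2\<bar> < 1"
    using interior_CFT_pd[OF q, of 1 0 1] interior_CFT_pd[OF q, of 1 0 "-1"] by simp
  show "\<bar>q$3\<bar> < 1"
    using interior_CFT_pd[OF q, of 1 1 0] interior_CFT_pd[OF q, of 1 "-1" 0] by simp
  define u v w where uvw: "u = q$1" "v = q$2" "w = q$3"
  have u2: "1 - u\<^sup>2 > 0" using u by (simp add: uvw abs_square_less_1)
  \<comment> \<open>The test vector is the first row of the adjugate of the Gram matrix, on which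
    the form takes the value \<open>(1-u^2)\<close> times the determinant.\<close>
  have "(1-u\<^sup>2)\<^sup>2 + (u * v - w)\<^sup>2 + (u*w - v)\<^sup>2 + 2*(u * v - w)*(u*w - v)*u + 2*(1-u\<^sup>2)*(u*w - v) * v + 2*(1-u\<^sup>2)*(u * v - w)*w > 0"
    unfolding uvw by (rule interior_CFT_pd[OF q]) (use u2 in \<open>simp add: uvw\<close>)
  also have "(1-u\<^sup>2)\<^sup>2 + (u * v - w)\<^sup>2 + (u*w - v)\<^sup>2 + 2*(u * v - w)*(u*w - v)*u + 2*(1-u\<^sup>2)*(u*w - v) * v + 2*(1-u\<^sup>2)*(u * v - w)*w
      = (1-u\<^sup>2) * gram u v w"
    by (simp add: gram_def power2_eq_square algebra_simps)
  finally show "gram (q$1) (q$2) (q$3) > 0" using u2 by (simp add: uvw zero_less_mult_iff)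
qed

text \<open>The distances of apexes whose images converge to \<open>q\<close> are solutions, and
  they have a limit point by \<open>p3p_limit\<close>.\<close>

lemma CFT_nonneg_solution:
  assumes q: "q \<in> CFT A B C" and b: "\<bar>q$1\<bar> < 1" "\<bar>q$2\<bar> < 1"
  shows "\<exists>x\<ge>0. \<exists>y\<ge>0. \<exists>z\<ge>0. p3p (dist B C) (dist A C) (dist A B) (q$1) (q$2) (q$3) x y z"
proof -
  obtain Q where Q: "\<And>n. Q n \<in> cos_triple A B C ` GT A B C" "Q \<longlonglongrightarrow> q"
    using q unfolding CFT_def closure_sequential by blast
  then have "\<forall>n. \<exists>D. D \<in> GT A B C \<and> Q n = cos_triple A B C D" by blast
  then obtain D where D: "\<And>n. D n \<in> GT A B C" "\<And>n. Q n = cos_triple A B C (D n)" by metis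
  have "0 \<le> dist A (D n) \<and> 0 \<le> dist B (D n) \<and> 0 \<le> dist C (D n) \<and>
    p3p (dist B C) (dist A C) (dist A B) (Q n $ 1) (Q n $ 2) (Q n $ 3) (dist A (D n)) (dist B (D n)) (dist C (D n))" for n
    using p3p_dist[of "D n"] GT_ne[OF D(1)[of n]] by (simp add: D(2) cos_triple_def)
  from p3p_limit[OF tendsto_vec_nth[OF Q(2)] tendsto_vec_nth[OF Q(2)] tendsto_vec_nth[OF Q(2)] b this]
  show ?thesis by metis
qed

lemma interior_CFT_subset: "interior (CFT A B C) \<subseteq> cos_triple A B C ` Pi_plus"
proof
  fix q assume q: "q \<in> interior (CFT A B C)"
  note b = interior_CFT_gram[OF q]
  obtain e where e: "e > 0" "ball q e \<subseteq> CFT A B C" using q by (meson mem_interior)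
  \<comment> \<open>The third of \<open>e\<close> keeps the sum of three coordinate changes below
    \<open>e\<close>; the other bounds keep the first two coordinates inside
    \<open>(-1, 1)\<close>.\<close>
  define d where "d = min (e/3) (min (1 - \<bar>q$1\<bar>) (1 - \<bar>q$2\<bar>))"
  have near: "p3p_near (dist B C) (dist A C) (dist A B) (q$1) (q$2) (q$3)"
    unfolding p3p_near_def
  proof (rule exI[of _ d], intro conjI allI impI)
    show "d > 0" using e b by (simp add: d_def)
    fix u v w assume uvw: "\<bar>u - q$1\<bar> < d \<and> \<bar>v - q$2\<bar> < d \<and> \<bar>w - q$3\<bar> < d"
    define p :: "real^3" where "p = vector [u, v, w]"
    have "norm (p - q) \<le> \<bar>u - q$1\<bar> + \<bar>v - q$2\<bar> + \<bar>w - q$3\<bar>"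
      using norm_le_l1_cart[of "p - q"] by (simp add: sum_3 p_def)
    also have "\<dots> < e" using uvw by (simp add: d_def)
    finally have "p \<in> CFT A B C" using e(2) by (auto simp: dist_norm norm_minus_commute)
    moreover have "\<bar>p$1\<bar> < 1" "\<bar>p$2\<bar> < 1"
    proof -
      have "\<bar>u - q$1\<bar> < 1 - \<bar>q$1\<bar>" "\<bar>v - q$2\<bar> < 1 - \<bar>q$2\<bar>" using uvw by (simp_all add: d_def)
      then show "\<bar>p$1\<bar> < 1" "\<bar>p$2\<bar> < 1" by (simp_all add: p_def)
    qed
    ultimately show "\<exists>x\<ge>0. \<exists>y\<ge>0. \<exists>z\<ge>0. p3p (dist B C) (dist A C) (dist A B) u v w x y z"
      using CFT_nonneg_solution[of p] by (simp add: p_def)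
  qed
  show "q \<in> cos_triple A B C ` Pi_plus"
    unfolding image_Pi_plus_iff using p3p_near_imp_positive[OF tri_ABC near b(4,1,2,3)] b(4) by blast
qed

end

subsection \<open>The map off the cylinder\<close>

lemma has_derivative_vec3:
  fixes f :: "real^3 \<Rightarrow> real^3"
  assumes "\<And>i. ((\<lambda>p. f p $ i) has_derivative (\<lambda>h. f' h $ i)) (at x)"
  shows "(f has_derivative f') (at x)"
  unfolding has_derivative_componentwise_within[of f f' x UNIV]
  using assms by (auto simp: Basis_vec_def inner_axis)

lemma law_of_cosines_derivative:
  fixes x :: "real^3" and i j :: 3 and k :: real
  assumes pos: "x$i > 0" "x$j > 0"
  defines "u \<equiv> ((x$i)\<^sup>2 + (x$j)\<^sup>2 - k) / (2 * x$i * x$j)"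
  shows "((\<lambda>p. ((p$i)\<^sup>2 + (p$j)\<^sup>2 - k) / (2 * p$i * p$j)) has_derivative
    (\<lambda>h. ((x$i - x$j*u) * h$i + (x$j - x$i*u) * h$j) / (x$i * x$j))) (at x)"
proof -
  have d: "((\<lambda>p. p$l) has_derivative (\<lambda>h. h$l)) (at x)" for l :: 3
    by (rule bounded_linear_imp_has_derivative) (rule bounded_linear_vec_nth)
  have n: "2 * x$i * x$j \<noteq> 0" using pos by simp
  have num: "((\<lambda>p. (p$i)\<^sup>2 + (p$j)\<^sup>2 - k) has_derivative (\<lambda>h. 2 * x$i * h$i + 2 * x$j * h$j)) (at x)"
    by (auto intro!: derivative_eq_intros d)
  have den: "((\<lambda>p. 2 * p$i * p$j) has_derivative (\<lambda>h. 2 * x$i * h$j + 2 * x$j * h$i)) (at x)"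
    by (auto intro!: derivative_eq_intros d)
  note has_derivative_divide'[OF num den n]
  moreover have "(2 * x$i * h$i + 2 * x$j * h$j) * (2 * x$i * x$j) - ((x$i)\<^sup>2 + (x$j)\<^sup>2 - k) * (2 * x$i * h$j + 2 * x$j * h$i)
      = (4 * (x$i * x$j)) * ((x$i - x$j*u) * h$i + (x$j - x$i*u) * h$j)" for h
  proof -
    have "(x$i)\<^sup>2 + (x$j)\<^sup>2 - k = 2 * x$i * x$j * u" using n by (simp add: u_def)
    then show ?thesis by (simp add: algebra_simps)
  qed
  moreover have "(4 * (x$i * x$j)) * w / ((2 * x$i * x$j) * (2 * x$i * x$j)) = w / (x$i * x$j)" for w
    using pos by (simp add: field_simps)
  ultimately show ?thesis by simp
qed

text \<open>\<open>Psi\<close> solves the laws for the cosines in terms of the distances. Up to a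
  nonzero factor its Jacobian determinant is the expression in the last hypothesis, so its
  derivative \<open>L\<close> is invertible and the open mapping theorem applies.\<close>

lemma p3p_interior:
  fixes a b c u v w x y z :: real
  assumes p: "p3p a b c u v w x y z" and pos: "x > 0" "y > 0" "z > 0"
    and J: "(y - z*u)*(z - x * v)*(x - y*w) + (z - y*u)*(x - z * v)*(y - x*w) \<noteq> 0"
  shows "(vector [u, v, w] :: real^3) \<in> interior {q. \<exists>x>0. \<exists>y>0. \<exists>z>0. p3p a b c (q$1) (q$2) (q$3) x y z}"
proof -
  define Psi :: "real^3 \<Rightarrow> real^3" where
    "Psi = (\<lambda>p. vector [((p$2)\<^sup>2 + (p$3)\<^sup>2 - a\<^sup>2) / (2 * p$2 * p$3), ((p$1)\<^sup>2 + (p$3)\<^sup>2 - b\<^sup>2) / (2 * p$1 * p$3),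
      ((p$1)\<^sup>2 + (p$2)\<^sup>2 - c\<^sup>2) / (2 * p$1 * p$2)])"
  define S :: "(real^3) set" where "S = {p. p$1 > 0 \<and> p$2 > 0 \<and> p$3 > 0}"
  define p0 :: "real^3" where "p0 = vector [x, y, z]"
  define L :: "real^3 \<Rightarrow> real^3" where
    "L = (\<lambda>h. vector [((y - z*u) * h$2 + (z - y*u) * h$3) / (y*z), ((x - z * v) * h$1 + (z - x * v) * h$3) / (x*z),
      ((x - y*w) * h$1 + (y - x*w) * h$2) / (x*y)])"
  have oS: "open S" unfolding S_def
    by (intro open_Collect_conj open_Collect_less continuous_intros)
  have p0S: "p0 \<in> S" using pos by (simp add: S_def p0_def)
  have uvw: "(y\<^sup>2 + z\<^sup>2 - a\<^sup>2) / (2*y*z) = u" "(x\<^sup>2 + z\<^sup>2 - b\<^sup>2) / (2*x*z) = v" "(x\<^sup>2 + y\<^sup>2 - c\<^sup>2) / (2*x*y) = w"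
  proof -
    have "y\<^sup>2 + z\<^sup>2 - a\<^sup>2 = 2*y*z*u" "x\<^sup>2 + z\<^sup>2 - b\<^sup>2 = 2*x*z * v" "x\<^sup>2 + y\<^sup>2 - c\<^sup>2 = 2*x*y*w"
      using p by (auto simp: p3p_def)
    then show "(y\<^sup>2 + z\<^sup>2 - a\<^sup>2) / (2*y*z) = u" "(x\<^sup>2 + z\<^sup>2 - b\<^sup>2) / (2*x*z) = v" "(x\<^sup>2 + y\<^sup>2 - c\<^sup>2) / (2*x*y) = w"
      using pos by simp_all
  qed
  have Psi0: "Psi p0 = vector [u, v, w]" by (simp add: Psi_def p0_def uvw)
  have contPsi: "continuous_on S Psi"
  proof -
    have "continuous_on S (\<lambda>p. ((p$2)\<^sup>2 + (p$3)\<^sup>2 - a\<^sup>2) / (2 * p$2 * p$3))"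
      "continuous_on S (\<lambda>p. ((p$1)\<^sup>2 + (p$3)\<^sup>2 - b\<^sup>2) / (2 * p$1 * p$3))"
      "continuous_on S (\<lambda>p. ((p$1)\<^sup>2 + (p$2)\<^sup>2 - c\<^sup>2) / (2 * p$1 * p$2))"
      by (auto simp: S_def intro!: continuous_intros)
    then have "continuous_on S (\<lambda>p. Psi p $ i)" for i
      using exhaust_3[of i] by (auto simp: Psi_def)
    then have "continuous_on S (\<lambda>p. \<chi> i. Psi p $ i)" by (rule continuous_on_vec_lambda)
    then show ?thesis by (simp add: vec_lambda_eta)
  qed
  have der: "(Psi has_derivative L) (at p0)"
  proof (rule has_derivative_vec3)
    fix i :: 3
    have "p0$1 > 0" "p0$2 > 0" "p0$3 > 0" using p0S by (auto simp: S_def)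
    note D = law_of_cosines_derivative[OF this(2,3), of "a\<^sup>2"] law_of_cosines_derivative[OF this(1,3), of "b\<^sup>2"]
      law_of_cosines_derivative[OF this(1,2), of "c\<^sup>2"]
    show "((\<lambda>p. Psi p $ i) has_derivative (\<lambda>h. L h $ i)) (at p0)"
      using exhaust_3[of i] D by (auto simp: Psi_def L_def p0_def uvw)
  qed
  have linL: "linear L" using has_derivative_linear[OF der] .
  have "inj L"
    unfolding linear_injective_0[OF linL]
  proof (intro allI impI)
    fix h assume h: "L h = 0"
    define d where "d = (y - z*u)*(z - x * v)*(x - y*w) + (z - y*u)*(x - z * v)*(y - x*w)"
    have e: "(y - z*u) * h$2 + (z - y*u) * h$3 = 0" "(x - z * v) * h$1 + (z - x * v) * h$3 = 0"
      "(x - y*w) * h$1 + (y - x*w) * h$2 = 0"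
      using h pos by (auto simp: L_def vec_eq_iff forall_3)
    \<comment> \<open>Cramer's rule for the homogeneous system: each line combines the three
      equations with cofactors.\<close>
    have el: "(p1*q2*r1 + p2*q1*r2) * h1 = 0" "(p1*q2*r1 + p2*q1*r2) * h2 = 0" "(p1*q2*r1 + p2*q1*r2) * h3 = 0"
      if "p1*h2 + p2*h3 = 0" "q1*h1 + q2*h3 = 0" "r1*h1 + r2*h2 = 0" for p1 p2 q1 q2 r1 r2 h1 h2 h3 :: real
    proof -
      have "(p1*q2*r1 + p2*q1*r2) * h1 = p1*q2*(r1*h1 + r2*h2) + p2*r2*(q1*h1 + q2*h3) - q2*r2*(p1*h2 + p2*h3)"
        "(p1*q2*r1 + p2*q1*r2) * h2 = q2*r1*(p1*h2 + p2*h3) + p2*q1*(r1*h1 + r2*h2) - p2*r1*(q1*h1 + q2*h3)"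
        "(p1*q2*r1 + p2*q1*r2) * h3 = p1*r1*(q1*h1 + q2*h3) + q1*r2*(p1*h2 + p2*h3) - p1*q1*(r1*h1 + r2*h2)"
        by (simp_all add: algebra_simps)
      then show "(p1*q2*r1 + p2*q1*r2) * h1 = 0" "(p1*q2*r1 + p2*q1*r2) * h2 = 0" "(p1*q2*r1 + p2*q1*r2) * h3 = 0"
        unfolding that by simp_all
    qed
    have "d * h$1 = 0" "d * h$2 = 0" "d * h$3 = 0"
      unfolding d_def by (rule el[OF e])+
    then show "h = 0" using J unfolding d_def[symmetric] by (simp add: vec_eq_iff forall_3)
  qed
  then obtain g where g: "linear g" "\<And>x. L (g x) = x"
    using linear_injective_isomorphism[OF linL] by blast
  have "Psi p0 \<in> interior (Psi ` S)"
  proof (rule sussmann_open_mapping[OF oS contPsi p0S der])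
    show "bounded_linear g" using g(1) by (simp add: linear_conv_bounded_linear)
    show "L \<circ> g = id" using g(2) by auto
    show "S \<subseteq> S" "p0 \<in> interior S" using oS p0S by (auto simp: interior_open)
  qed
  moreover have "Psi ` S \<subseteq> {q. \<exists>x>0. \<exists>y>0. \<exists>z>0. p3p a b c (q$1) (q$2) (q$3) x y z}"
  proof (rule image_subsetI)
    fix p assume "p \<in> S"
    then have pp: "p$1 > 0" "p$2 > 0" "p$3 > 0" by (auto simp: S_def)
    then have "p3p a b c (Psi p$1) (Psi p$2) (Psi p$3) (p$1) (p$2) (p$3)"
      by (simp add: p3p_def Psi_def)
    then show "Psi p \<in> {q. \<exists>x>0. \<exists>y>0. \<exists>z>0. p3p a b c (q$1) (q$2) (q$3) x y z}" using pp by blast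
  qed
  ultimately show ?thesis unfolding Psi0 using interior_mono by blast
qed

text \<open>
  The left-hand side is \<open>8xyz\<close> times the Jacobian of \<open>p3p_interior\<close>; on the right the power of \<open>(s, t)\<close>
  with respect to the circle through \<open>0\<close>, \<open>(p1, p2)\<close> and \<open>(r1, r2)\<close>, times \<open>d\<close>, appears.
\<close>

lemma danger_cylinder_identity:
  fixes s t h p1 p2 r1 r2 :: real
  defines "X \<equiv> s\<^sup>2 + t\<^sup>2 + h\<^sup>2" and "Y \<equiv> (s-p1)\<^sup>2 + (t-p2)\<^sup>2 + h\<^sup>2" and "Z \<equiv> (s-r1)\<^sup>2 + (t-r2)\<^sup>2 + h\<^sup>2"
    and "a2 \<equiv> (p1-r1)\<^sup>2 + (p2-r2)\<^sup>2" and "b2 \<equiv> r1\<^sup>2 + r2\<^sup>2" and "c2 \<equiv> p1\<^sup>2 + p2\<^sup>2" and "d \<equiv> p1*r2 - p2*r1"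
  shows "(Y - Z + a2)*(Z - X + b2)*(X - Y + c2) + (Z - Y + a2)*(X - Z + b2)*(Y - X + c2)
    = - (8 * d * (d*(s\<^sup>2 + t\<^sup>2) - s*(c2*r2 - b2*p2) - t*(b2*p1 - c2*r1)))"
  unfolding assms by (simp add: power2_eq_square algebra_simps)

context base_triangle
begin

lemma Cyl_iff: "D \<in> Cyl A B C \<longleftrightarrow> vector [D$1, D$2, 0] \<in> circumcircle A B C"
proof
  assume "vector [D$1, D$2, 0] \<in> circumcircle A B C"
  moreover have "D = vector [D$1, D$2, D$3]" by (simp add: vec_eq_iff forall_3)
  ultimately show "D \<in> Cyl A B C" unfolding Cyl_def by blast
qed (auto simp: Cyl_def)

text \<open>Each factor of the Jacobian, multiplied by twice a distance, is a combination of squared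
  distances by the cosine laws. So \<open>danger_cylinder_identity\<close> applies, and after
  cancelling the area the equation of the circumscribed circle remains.\<close>

lemma critical_imp_Cyl:
  assumes p: "p3p (dist B C) (dist A C) (dist A B) u v w x y z"
    and xyz: "x = dist A D" "y = dist B D" "z = dist C D" and pos: "x > 0" "y > 0" "z > 0"
    and J: "(y - z*u)*(z - x * v)*(x - y*w) + (z - y*u)*(x - z * v)*(y - x*w) = 0"
  shows "D \<in> Cyl A B C"
proof -
  define s where "s = D$1 - A$1"
  define t where "t = D$2 - A$2"
  define p1 where "p1 = B$1 - A$1"
  define p2 where "p2 = B$2 - A$2"
  define r1 where "r1 = C$1 - A$1"
  define r2 where "r2 = C$2 - A$2"
  define b2 where "b2 = r1\<^sup>2 + r2\<^sup>2"
  define c2 where "c2 = p1\<^sup>2 + p2\<^sup>2"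
  note defs = s_def t_def p1_def p2_def r1_def r2_def
  have d: "\<Delta> = p1*r2 - p2*r1" by (simp add: \<Delta>_def defs)
  have e: "y\<^sup>2 + z\<^sup>2 - 2*y*z*u = (dist B C)\<^sup>2" "x\<^sup>2 + z\<^sup>2 - 2*x*z * v = (dist A C)\<^sup>2" "x\<^sup>2 + y\<^sup>2 - 2*x*y*w = (dist A B)\<^sup>2"
    using p by (auto simp: p3p_def)
  have q: "x\<^sup>2 = s\<^sup>2 + t\<^sup>2 + (D$3)\<^sup>2" "y\<^sup>2 = (s-p1)\<^sup>2 + (t-p2)\<^sup>2 + (D$3)\<^sup>2" "z\<^sup>2 = (s-r1)\<^sup>2 + (t-r2)\<^sup>2 + (D$3)\<^sup>2"
    "(dist B C)\<^sup>2 = (p1-r1)\<^sup>2 + (p2-r2)\<^sup>2" "(dist A C)\<^sup>2 = b2" "(dist A B)\<^sup>2 = c2"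
    unfolding xyz dist_sq flat b2_def c2_def by (simp_all add: defs power2_commute)
  have f: "2*y*(y - z*u) = y\<^sup>2 - z\<^sup>2 + (dist B C)\<^sup>2" "2*z*(z - y*u) = z\<^sup>2 - y\<^sup>2 + (dist B C)\<^sup>2"
    "2*z*(z - x * v) = z\<^sup>2 - x\<^sup>2 + (dist A C)\<^sup>2" "2*x*(x - z * v) = x\<^sup>2 - z\<^sup>2 + (dist A C)\<^sup>2"
    "2*x*(x - y*w) = x\<^sup>2 - y\<^sup>2 + (dist A B)\<^sup>2" "2*y*(y - x*w) = y\<^sup>2 - x\<^sup>2 + (dist A B)\<^sup>2"
    unfolding e[symmetric] by (simp_all add: power2_eq_square algebra_simps)
  have "0 = 8*x*y*z * ((y - z*u)*(z - x * v)*(x - y*w) + (z - y*u)*(x - z * v)*(y - x*w))" using J by simp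
  also have "\<dots> = (2*y*(y - z*u))*(2*z*(z - x * v))*(2*x*(x - y*w)) + (2*z*(z - y*u))*(2*x*(x - z * v))*(2*y*(y - x*w))"
    by (simp add: algebra_simps)
  also have "\<dots> = - (8 * \<Delta> * (\<Delta>*(s\<^sup>2 + t\<^sup>2) - s*(c2*r2 - b2*p2) - t*(b2*p1 - c2*r1)))"
    unfolding f q d unfolding b2_def c2_def by (rule danger_cylinder_identity)
  finally have inc: "\<Delta>*(s\<^sup>2 + t\<^sup>2) - s*(c2*r2 - b2*p2) - t*(b2*p1 - c2*r1) = 0" using \<Delta>_nz by simp
  \<comment> \<open>\<open>(k1, k2)\<close> is the point opposite to \<open>A\<close> on the
    circumscribed circle, relative to \<open>A\<close>. With \<open>A\<close> as origin the circle
    consists of the points whose squared norm equals their inner product with it.\<close>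
  define k1 where "k1 = (c2*r2 - b2*p2) / \<Delta>"
  define k2 where "k2 = (b2*p1 - c2*r1) / \<Delta>"
  have k: "\<Delta> * k1 = c2*r2 - b2*p2" "\<Delta> * k2 = b2*p1 - c2*r1" using \<Delta>_nz by (simp_all add: k1_def k2_def)
  have "\<Delta> * (s\<^sup>2 + t\<^sup>2 - s*k1 - t*k2) = \<Delta>*(s\<^sup>2 + t\<^sup>2) - s*(\<Delta>*k1) - t*(\<Delta>*k2)" by (simp add: algebra_simps)
  then have kD: "s\<^sup>2 + t\<^sup>2 = s*k1 + t*k2" using inc \<Delta>_nz unfolding k by simp
  have "\<Delta> * (p1*k1 + p2*k2) = p1*(\<Delta>*k1) + p2*(\<Delta>*k2)" by (simp add: algebra_simps)
  also have "\<dots> = \<Delta> * c2" unfolding k unfolding d by (simp add: algebra_simps)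
  finally have kB: "p1\<^sup>2 + p2\<^sup>2 = p1*k1 + p2*k2" using \<Delta>_nz by (simp add: c2_def)
  have "\<Delta> * (r1*k1 + r2*k2) = r1*(\<Delta>*k1) + r2*(\<Delta>*k2)" by (simp add: algebra_simps)
  also have "\<dots> = \<Delta> * b2" unfolding k unfolding d by (simp add: algebra_simps)
  finally have kC: "r1\<^sup>2 + r2\<^sup>2 = r1*k1 + r2*k2" using \<Delta>_nz by (simp add: b2_def)
  define Z :: "real^3" where "Z = vector [A$1 + k1/2, A$2 + k2/2, 0]"
  have onc: "(dist Z P)\<^sup>2 = (k1/2)\<^sup>2 + (k2/2)\<^sup>2"
    if "P$3 = 0" "(P$1 - A$1)\<^sup>2 + (P$2 - A$2)\<^sup>2 = (P$1 - A$1)*k1 + (P$2 - A$2)*k2" for P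
    unfolding dist_sq using that by (simp add: Z_def power2_eq_square algebra_simps)
  define D0 :: "real^3" where "D0 = vector [D$1, D$2, 0]"
  have "(dist Z A)\<^sup>2 = (k1/2)\<^sup>2 + (k2/2)\<^sup>2" "(dist Z B)\<^sup>2 = (k1/2)\<^sup>2 + (k2/2)\<^sup>2"
    "(dist Z C)\<^sup>2 = (k1/2)\<^sup>2 + (k2/2)\<^sup>2" "(dist Z D0)\<^sup>2 = (k1/2)\<^sup>2 + (k2/2)\<^sup>2"
    using kB kC kD by (auto intro!: onc simp: flat defs D0_def)
  then have "(dist Z A)\<^sup>2 = (dist Z B)\<^sup>2" "(dist Z B)\<^sup>2 = (dist Z C)\<^sup>2" "(dist Z D0)\<^sup>2 = (dist Z A)\<^sup>2"
    by simp_all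
  then have "dist Z A = dist Z B \<and> dist Z B = dist Z C \<and> dist Z D0 = dist Z A"
    by (simp add: power2_eq_iff_nonneg)
  then have "D0 \<in> circumcircle A B C"
    unfolding circumcircle_def by (auto simp: Pi_zero_iff Z_def D0_def intro!: bexI[of _ Z])
  then show ?thesis by (simp add: Cyl_iff D0_def)
qed

lemma image_subset_CFT: "cos_triple A B C ` Pi_plus \<subseteq> CFT A B C"
  unfolding CFT_def by (rule order_trans[OF image_mono closure_subset]) (simp add: GT_def)

lemma open_gram: "open {q :: real^3. gram (q$1) (q$2) (q$3) > 0}"
  unfolding gram_def by (intro open_Collect_less continuous_intros)

lemma off_Cyl_interior:
  assumes D: "D \<in> Pi_plus" "D \<notin> Cyl A B C"
  shows "cos_triple A B C D \<in> interior (CFT A B C)"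
proof -
  define u v w where uvw: "u = cos (angle B D C)" "v = cos (angle A D C)" "w = cos (angle A D B)"
  define x y z where xyz: "x = dist A D" "y = dist B D" "z = dist C D"
  have p: "p3p (dist B C) (dist A C) (dist A B) u v w x y z"
    unfolding uvw xyz using p3p_dist Pi_plus_ne[OF D(1)] by blast
  have pos: "x > 0" "y > 0" "z > 0" using Pi_plus_ne[OF D(1)] by (auto simp: xyz)
  have J: "(y - z*u)*(z - x * v)*(x - y*w) + (z - y*u)*(x - z * v)*(y - x*w) \<noteq> 0"
    using critical_imp_Cyl[OF p xyz pos] D(2) by blast
  let ?P = "{q :: real^3. \<exists>x>0. \<exists>y>0. \<exists>z>0. p3p (dist B C) (dist A C) (dist A B) (q$1) (q$2) (q$3) x y z}"
  let ?G = "{q :: real^3. gram (q$1) (q$2) (q$3) > 0}"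
  have F: "cos_triple A B C D = vector [u, v, w]" by (simp add: cos_triple_def uvw)
  have "cos_triple A B C D \<in> interior ?P" unfolding F by (rule p3p_interior[OF p pos J])
  moreover have "cos_triple A B C D \<in> interior ?G"
    unfolding interior_open[OF open_gram] F using gram_pos[OF D(1)] by (simp add: uvw)
  ultimately have "cos_triple A B C D \<in> interior (?P \<inter> ?G)" by simp
  moreover have "?P \<inter> ?G \<subseteq> cos_triple A B C ` Pi_plus" using image_Pi_plus_iff by blast
  ultimately show ?thesis using interior_mono image_subset_CFT by (meson subset_trans subsetD)
qed

end

subsection \<open>The map on the cylinder\<close>

lemma gram_swap: "gram u v w = gram v u w" "gram u v w = gram u w v"
  by (simp_all add: gram_def algebra_simps)

lemma gram_pos_less_one:
  assumes g: "gram u v w > 0" and b: "\<bar>u\<bar> \<le> 1"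
  shows "u\<^sup>2 < 1"
proof -
  have "u\<^sup>2 \<noteq> 1"
  proof
    assume e: "u\<^sup>2 = 1"
    have "gram u v w = (1 - u\<^sup>2) * (1 - v\<^sup>2) - (w - u * v)\<^sup>2"
      by (simp add: gram_def power2_eq_square algebra_simps)
    also have "\<dots> \<le> 0" unfolding e by simp
    finally show False using g by simp
  qed
  moreover have "u\<^sup>2 \<le> 1" using b by (simp add: abs_square_le_1)
  ultimately show ?thesis by linarith
qed

lemma p3p_exists_tri:
  assumes t: "tri a b c c1 c2 c3" and "u > c1" "v > c2" "u\<^sup>2 < 1" "v\<^sup>2 < 1"
  shows "\<exists>x>0. \<exists>y>0. \<exists>z>0. p3p a b c u v w x y z"
  by (rule p3p_exists[OF triD(1-3,7,8)[OF t] assms(2,4,3,5)])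

lemma p3p_exists_two:
  assumes t: "tri a b c c1 c2 c3" and b: "u\<^sup>2 < 1" "v\<^sup>2 < 1" "w\<^sup>2 < 1"
    and two: "u > c1 \<and> v > c2 \<or> u > c1 \<and> w > c3 \<or> v > c2 \<and> w > c3"
  shows "\<exists>x>0. \<exists>y>0. \<exists>z>0. p3p a b c u v w x y z"
proof -
  consider "u > c1" "v > c2" | "u > c1" "w > c3" | "v > c2" "w > c3" using two by blast
  then show ?thesis
  proof cases
    case 1
    then show ?thesis by (rule p3p_exists_tri[OF t _ _ b(1,2)])
  next
    case 2
    from p3p_exists_tri[OF tri_swap23[OF t] this b(1,3), of v]
    obtain x y z where "x > 0" "y > 0" "z > 0" "p3p a c b u w v x y z" by (elim exE conjE)
    moreover from this have "p3p a b c u v w x z y" by (subst p3p_swap23)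
    ultimately show ?thesis by auto
  next
    case 3
    from p3p_exists_tri[OF tri_swap23[OF tri_swap12[OF t]] this b(2,3), of u]
    obtain x y z where "x > 0" "y > 0" "z > 0" "p3p b c a v w u x y z" by (elim exE conjE)
    moreover from this have "p3p a b c u v w z x y" by (subst p3p_swap12, subst p3p_swap23)
    ultimately show ?thesis by auto
  qed
qed

lemma cos_angle_eq_iff: "angle K M L = angle K' M' L' \<longleftrightarrow> cos (angle K M L) = cos (angle K' M' L')"
proof
  assume "cos (angle K M L) = cos (angle K' M' L')"
  then show "angle K M L = angle K' M' L'"
    unfolding cos_angle unfolding angle_def by simp
qed simp

text \<open>
  As the apex rises along a vertical line its angle over \<open>K L\<close> tends to \<open>0\<close>; apply the intermediate value theorem.
\<close>

lemma angle_above: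
  assumes KL: "K$3 = 0" "L$3 = 0" and D: "D$3 > 0" and le: "cos (angle K D L) \<le> k" and k: "k < 1"
  shows "\<exists>r\<ge>D$3. cos (angle K (vector [D$1, D$2, r]) L) = k"
proof -
  define V :: "real \<Rightarrow> real^3" where "V = (\<lambda>r. vector [D$1, D$2, r])"
  define a2 where "a2 = (dist K L)\<^sup>2"
  \<comment> \<open>With \<open>S = y^2 + z^2 >= H^2 >= H\<close>, the quotient in \<open>H\<close>
    yields \<open>S - a2 >= k * S\<close>, and the last summand makes \<open>S - a2\<close>
    nonnegative, which settles negative \<open>k\<close>.\<close>
  define H where "H = D$3 + 1 + a2 / (1 - k) + a2"
  have q0: "a2 / (1 - k) \<ge> 0" "a2 \<ge> 0" using k by (simp_all add: a2_def)
  have H: "H \<ge> D$3" "H \<ge> 1" "H \<ge> a2 / (1 - k)" "H \<ge> a2" using q0 D by (auto simp: H_def)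
  have VD: "V (D$3) = D" by (simp add: V_def vec_eq_iff forall_3)
  have ne: "V r \<noteq> K" "V r \<noteq> L" if "r > 0" for r
    using that KL by (auto simp: V_def vec_eq_iff forall_3)
  have cV: "continuous_on {D$3..H} V"
  proof -
    have "continuous_on {D$3..H} (\<lambda>r. D$1)" "continuous_on {D$3..H} (\<lambda>r. D$2)" "continuous_on {D$3..H} (\<lambda>r. r)"
      by (intro continuous_intros)+
    then have "continuous_on {D$3..H} (\<lambda>r. V r $ i)" for i
      using exhaust_3[of i] by (auto simp: V_def)
    then have "continuous_on {D$3..H} (\<lambda>r. \<chi> i. V r $ i)" by (rule continuous_on_vec_lambda)
    then show ?thesis by (simp add: vec_lambda_eta)
  qed
  define f where "f = (\<lambda>r. cos (angle K (V r) L))"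
  have cf: "continuous_on {D$3..H} f"
  proof -
    have "\<forall>r\<in>{D$3..H}. norm (K - V r) * norm (L - V r) \<noteq> 0"
    proof
      fix r assume "r \<in> {D$3..H}"
      then have "r > 0" using D by simp
      then show "norm (K - V r) * norm (L - V r) \<noteq> 0" using ne[of r] by simp
    qed
    then show ?thesis unfolding f_def cos_angle by (intro continuous_intros cV)
  qed
  have "f H \<ge> k"
  proof -
    define y where "y = dist K (V H)"
    define z where "z = dist L (V H)"
    have H0: "H > 0" using H by simp
    have yz: "y > 0" "z > 0" using ne[OF H0] by (auto simp: y_def z_def)
    have "y\<^sup>2 \<ge> H\<^sup>2" unfolding y_def dist_sq using KL by (simp add: V_def)
    moreover have "H\<^sup>2 \<ge> H" using H(2) by (simp add: power2_eq_square)
    moreover have "z\<^sup>2 \<ge> 0" by simp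
    ultimately have S: "y\<^sup>2 + z\<^sup>2 \<ge> a2 / (1 - k)" "y\<^sup>2 + z\<^sup>2 \<ge> a2" using H by linarith+
    then have "(y\<^sup>2 + z\<^sup>2) * (1 - k) \<ge> a2" using S(1) k by (simp add: divide_le_eq)
    then have 1: "y\<^sup>2 + z\<^sup>2 - a2 \<ge> k * (y\<^sup>2 + z\<^sup>2)" by (simp add: algebra_simps)
    have e: "2*y*z*f H = y\<^sup>2 + z\<^sup>2 - a2"
      using cosine_rule[of "V H" K L] ne[OF H0] by (simp add: y_def z_def a2_def f_def)
    have yz2: "2*y*z > 0" using yz by simp
    show ?thesis
    proof (cases "k < 0")
      case True
      have "2*y*z*f H \<ge> 0" using S(2) e by simp
      then have "f H \<ge> 0" using yz2 by (metis mult_less_0_iff not_le)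
      then show ?thesis using True by simp
    next
      case False
      have "0 \<le> (y - z)\<^sup>2" by simp
      then have "2*y*z \<le> y\<^sup>2 + z\<^sup>2" by (simp add: power2_eq_square algebra_simps)
      then have "k * (2*y*z) \<le> k * (y\<^sup>2 + z\<^sup>2)" using False by (intro mult_left_mono) auto
      then have "2*y*z * k \<le> 2*y*z * f H" using 1 e by (simp add: mult.commute)
      then show ?thesis using yz2 by (rule mult_left_le_imp_le)
    qed
  qed
  moreover have "f (D$3) \<le> k" using le by (simp add: f_def VD)
  ultimately obtain r where "r \<ge> D$3" "f r = k"
    using IVT'[of f "D$3" k H] cf H by auto
  then show ?thesis by (auto simp: f_def V_def)
qed

context base_triangle
begin

text \<open>A cosine not exceeding that of the triangle means an angle at \<open>D\<close> at least
  as large; raising \<open>D\<close> vertically inside the cylinder decreases it to the required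
  value by \<open>angle_above\<close>.\<close>

lemma above_in_gamma:
  assumes D: "D \<in> Cyl A B C" "D \<in> Pi_plus"
  shows "cos (angle B D C) \<le> cos (angle B A C) \<Longrightarrow> \<exists>r\<ge>D$3. vector [D$1, D$2, r] \<in> gamma_BC A B C"
    and "cos (angle A D C) \<le> cos (angle A B C) \<Longrightarrow> \<exists>r\<ge>D$3. vector [D$1, D$2, r] \<in> gamma_AC A B C"
    and "cos (angle A D B) \<le> cos (angle A C B) \<Longrightarrow> \<exists>r\<ge>D$3. vector [D$1, D$2, r] \<in> gamma_AB A B C"
proof -
  have *: "\<exists>r\<ge>D$3. vector [D$1, D$2, r] \<in> toroid K L (angle K M L) \<inter> Cyl A B C \<inter> Pi_plus"
    if KL: "K$3 = 0" "L$3 = 0" and le: "cos (angle K D L) \<le> cos (angle K M L)"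
      and lt: "(cos (angle K M L))\<^sup>2 < 1" for K L M
  proof -
    have D3: "D$3 > 0" using D(2) by (simp add: Pi_plus_iff)
    have "cos (angle K M L) < 1" using lt by (simp add: abs_square_less_1)
    then obtain r where r: "r \<ge> D$3" "cos (angle K (vector [D$1, D$2, r]) L) = cos (angle K M L)"
      using angle_above[OF KL D3 le] by blast
    let ?V = "vector [D$1, D$2, r] :: real^3"
    have "?V$3 > 0" using r(1) D3 by simp
    then have "?V \<noteq> K" "?V \<noteq> L" "?V \<in> Pi_plus" using KL by (auto simp: Pi_plus_iff)
    moreover have "?V \<in> Cyl A B C" using D(1) by (simp add: Cyl_iff)
    moreover have "angle K ?V L = angle K M L" using r(2) by (simp only: cos_angle_eq_iff)
    ultimately show ?thesis using r(1) unfolding toroid_def by blast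
  qed
  note lt = triD(4-6)[OF tri_ABC]
  show "cos (angle B D C) \<le> cos (angle B A C) \<Longrightarrow> \<exists>r\<ge>D$3. vector [D$1, D$2, r] \<in> gamma_BC A B C"
    unfolding gamma_BC_def by (rule *[OF flat(2,3) _ lt(1)])
  show "cos (angle A D C) \<le> cos (angle A B C) \<Longrightarrow> \<exists>r\<ge>D$3. vector [D$1, D$2, r] \<in> gamma_AC A B C"
    unfolding gamma_AC_def by (rule *[OF flat(1,3) _ lt(2)])
  show "cos (angle A D B) \<le> cos (angle A C B) \<Longrightarrow> \<exists>r\<ge>D$3. vector [D$1, D$2, r] \<in> gamma_AB A B C"
    unfolding gamma_AB_def by (rule *[OF flat(1,2) _ lt(3)])
qed

lemma in_SRT:
  assumes D: "D \<in> Cyl A B C" "D \<in> Pi_plus"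
    and 1: "\<exists>r\<ge>D$3. vector [D$1, D$2, r] \<in> \<gamma>" and 2: "\<exists>r\<ge>D$3. vector [D$1, D$2, r] \<in> \<gamma>'"
    and g: "(\<gamma>, \<gamma>') \<in> {(gamma_BC A B C, gamma_AC A B C), (gamma_BC A B C, gamma_AB A B C), (gamma_AC A B C, gamma_AB A B C)}"
  shows "D \<in> SRT A B C"
proof -
  have "\<gamma> \<noteq> {}" "\<gamma>' \<noteq> {}" using 1 2 by blast+
  then have R: "region_below A B C \<gamma> \<gamma>' \<in> special_regions A B C"
    unfolding special_regions_def using g by blast
  have e: "D = vector [D$1, D$2, D$3]" by (simp add: vec_eq_iff forall_3)
  have "D$3 > 0" using D(2) by (simp add: Pi_plus_iff)
  then have "D \<in> region_below A B C \<gamma> \<gamma>'"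
    unfolding region_below_def using D(1) 1 2 e by (intro CollectI exI[of _ "D$1"] exI[of _ "D$2"] exI[of _ "D$3"]) auto
  then show ?thesis unfolding SRT_def using D(1) R by blast
qed

lemma on_Cyl_interior:
  assumes D: "D \<in> Cyl A B C" "D \<in> Pi_plus" "D \<notin> SRT A B C"
  shows "cos_triple A B C D \<in> interior (CFT A B C)"
proof -
  define c1 where "c1 = cos (angle B A C)"
  define c2 where "c2 = cos (angle A B C)"
  define c3 where "c3 = cos (angle A C B)"
  have t: "tri (dist B C) (dist A C) (dist A B) c1 c2 c3" unfolding c1_def c2_def c3_def by (rule tri_ABC)
  define u where "u = cos (angle B D C)"
  define v where "v = cos (angle A D C)"
  define w where "w = cos (angle A D B)"
  note defs = c1_def c2_def c3_def u_def v_def w_def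
  \<comment> \<open>Otherwise two of the cosines do not exceed those of the triangle, so two of the
    curves pass through or above \<open>D\<close> and \<open>D\<close> lies in a special
    region.\<close>
  have two: "u > c1 \<and> v > c2 \<or> u > c1 \<and> w > c3 \<or> v > c2 \<and> w > c3"
  proof (rule ccontr)
    assume "\<not> ?thesis"
    then consider "u \<le> c1" "v \<le> c2" | "u \<le> c1" "w \<le> c3" | "v \<le> c2" "w \<le> c3" by linarith
    then have "D \<in> SRT A B C"
      unfolding defs
      by cases (rule in_SRT[OF D(1,2)], erule above_in_gamma[OF D(1,2)], erule above_in_gamma[OF D(1,2)], simp)+
    then show False using D(3) by simp
  qed
  \<comment> \<open>All conditions are strict inequalities, so they cut out an open set around the
    image of \<open>D\<close>, and \<open>p3p_exists_two\<close> solves the cosine laws on all of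
    it.\<close>
  define O' where "O' = {q :: real^3. gram (q$1) (q$2) (q$3) > 0 \<and> (q$1)\<^sup>2 < 1 \<and> (q$2)\<^sup>2 < 1 \<and> (q$3)\<^sup>2 < 1 \<and>
    (q$1 > c1 \<and> q$2 > c2 \<or> q$1 > c1 \<and> q$3 > c3 \<or> q$2 > c2 \<and> q$3 > c3)}"
  have "open O'"
    unfolding O'_def gram_def
    by (intro open_Collect_conj open_Collect_disj open_Collect_less continuous_intros)
  moreover have "O' \<subseteq> cos_triple A B C ` Pi_plus"
  proof
    fix q assume q: "q \<in> O'"
    then have g: "gram (q$1) (q$2) (q$3) > 0" and b: "(q$1)\<^sup>2 < 1" "(q$2)\<^sup>2 < 1" "(q$3)\<^sup>2 < 1"
      and tw: "q$1 > c1 \<and> q$2 > c2 \<or> q$1 > c1 \<and> q$3 > c3 \<or> q$2 > c2 \<and> q$3 > c3"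
      unfolding O'_def by blast+
    show "q \<in> cos_triple A B C ` Pi_plus"
      unfolding image_Pi_plus_iff using g p3p_exists_two[OF t b tw] by blast
  qed
  moreover have "cos_triple A B C D \<in> O'"
  proof -
    have g: "gram u v w > 0" unfolding defs by (rule gram_pos[OF D(2)])
    have "u\<^sup>2 < 1" using gram_pos_less_one[OF g] by (simp add: u_def)
    moreover have "v\<^sup>2 < 1" using gram_pos_less_one[of v u w] g gram_swap(1)[of u v w] by (simp add: v_def)
    moreover have "w\<^sup>2 < 1"
      using gram_pos_less_one[of w u v] g gram_swap(2)[of u v w] gram_swap(1)[of u w v] by (simp add: w_def)
    ultimately show ?thesis using g two by (simp add: O'_def cos_triple_def u_def v_def w_def)
  qed
  ultimately show ?thesis by (meson interiorI image_subset_CFT subset_trans)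
qed

end

theorem mainTheorem4:
  fixes A B C :: "real^3"
  assumes "A \<in> Pi_zero" and "B \<in> Pi_zero" and "C \<in> Pi_zero"
    and "\<not> collinear {A, B, C}"
  shows "Sigma_tri A B C = cos_triple A B C ` Pi_plus \<and>
         cos_triple A B C ` Pi_plus =
           interior (CFT A B C) \<union> cos_triple A B C ` SRT A B C"
proof -
  interpret base_triangle A B C
    using assms by unfold_locales (simp_all add: Pi_zero_iff)
  have "cos_triple A B C D \<in> interior (CFT A B C) \<union> cos_triple A B C ` SRT A B C" if "D \<in> Pi_plus" for D
    using off_Cyl_interior[OF that] on_Cyl_interior[OF _ that] by blast
  moreover have "cos_triple A B C ` SRT A B C \<subseteq> cos_triple A B C ` Pi_plus"
    by (rule image_mono) (rule SRT_subset)
  ultimately show ?thesis using Sigma_tri_eq interior_CFT_subset by blast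
qed

end
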